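(* For $1 \le k \le 13$ the values of the sequences $\mathrm{nM}, \mathrm{nM}_1, \mathrm{VDM}, \mathrm{VDH}, \mathrm{FCM}, \mathrm{FCH}, S_2$ at $k$ are as follows (each list gives the values for $k = 1, 2, \dots, 13$ in order): - $\mathrm{nM}(k)$: $2,4,5,6,8,9,10,11,12,13,14,16,17$; - $\mathrm{nM}_1(k)$: $2,4,5,6,8,8,10,11,12,13,14,16,16$; - $\mathrm{VDM}(k)$: $2,4,5,6,8,8,10,11,12,13,14,16,16$; - $\mathrm{VDH}(k)$: $2,4,5,6,8,8,10,11,12,13,14,16,16$; - $\mathrm{FCM}(k)$: $2,4,4,6,8,8,9,10,12,12,14,16,16$; - $\mathrm{FCH}(k)$: $2,4,4,6,8,8,8,10,12,12,14,16,16$; - $S_2(k)$: $2,4,4,6,8,8,8,10,12,12,14,16,16$.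
   Context: Clause-sets. There is an infinite set of variables (containing $\mathbb{N} = \{1,2,\dots\}$); literals are variables $v$ and their complements $\overline{v}$, with $\overline{\overline{x}} = x$. A clause is a finite set of literals not containing a complementary pair $x, \overline{x}$; a clause-set is a finite set of clauses. $\mathrm{var}(C)$ is the set of underlying variables of the literals of the clause $C$, and $\mathrm{var}(F) = \bigcup_{C \in F} \mathrm{var}(C)$. Put $n(F) = |\mathrm{var}(F)|$, $c(F) = |F|$, and deficiency $\delta(F) = c(F) - n(F)$. $F$ is satisfiable if there is a clause $C$ with $C \cap D \neq \emptyset$ for all $D \in F$, otherwise unsatisfiable. $\mathcal{MU}$ is the set of minimally unsatisfiable clause-sets: $F$ unsatisfiable with every proper subset of $F$ satisfiable. $\mathcal{UHIT}$ is the set of unsatisfiable hitting clause-sets: $F$ unsatisfiable such that for all $C, D \in F$ with $C \ne D$ there is $x \in C$ with $\overline{x} \in D$. A full clause of $F$ is $C \in F$ with $\mathrm{var}(C) = \mathrm{var}(F)$; $\mathrm{fc}(F)$ is the number of full clauses of $F$. For $\mathrm{var}(F) \ne \emptyset$ the min-var-degree is $\mu\mathrm{vd}(F) = \min_{v \in \mathrm{var}(F)} |\{C \in F : v \in \mathrm{var}(C)\}|$. The four fundamental quantities. For $k \in \mathbb{N}$: $\mathrm{FCH}(k)$ is the maximum of $\mathrm{fc}(F)$ over $F \in \mathcal{UHIT}$ with $\delta(F) = k$; $\mathrm{FCM}(k)$ is the maximum of $\mathrm{fc}(F)$ over $F \in \mathcal{MU}$ with $\delta(F) = k$; $\mathrm{VDH}(k)$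 is the maximum of $\mu\mathrm{vd}(F)$ over $F \in \mathcal{UHIT}$ with $\delta(F) = k$; $\mathrm{VDM}(k)$ is the maximum of $\mu\mathrm{vd}(F)$ over $F \in \mathcal{MU}$ with $\delta(F) = k$. For $k = 1$ the clause-set $\{\emptyset\}$ (containing only the empty clause) is excluded in the definitions of $\mathrm{VDH}$ and $\mathrm{VDM}$. Number sequences. $S_2(k)$, for $k \ge 1$, is the smallest integer $n \ge 0$ such that $2^k$ divides $n!$. $\mathrm{nM} : \mathbb{N} \to \mathbb{N}$ is the strictly increasing enumeration of the natural numbers $\ge 1$ not of the form $2^n - 1$, $n \in \mathbb{N}$. $\mathrm{nM}_1 : \mathbb{N} \to \mathbb{N}$ is defined by $\mathrm{nM}_1(2^n - n + 1) := \mathrm{nM}(2^n - n + 1) - 1 = 2^n$ for $n \ge 3$, and $\mathrm{nM}_1(k) := \mathrm{nM}(k)$ for all $k$ not of the form $2^n - n + 1$ with $n \ge 3$. *)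

theory Defs
  imports Main "HOL-Library.Infinite_Set" "HOL-Library.Infinite_Typeclass"
begin

text \<open>
  The type of variables is an arbitrary type \<open>'v\<close>; it is required to be infinite (class
  \<open>infinite\<close>) only where the four quantities below are formed. Clauses and clause-sets are
  sets of type \<open>'v lit set\<close> and \<open>'v lit set set\<close> cut out by predicates.
\<close>

datatype 'v lit = Pos 'v | Neg 'v

fun compl :: "'v lit \<Rightarrow> 'v lit" where
  "compl (Pos v) = Neg v"
| "compl (Neg v) = Pos v"

fun lit_var :: "'v lit \<Rightarrow> 'v" where
  "lit_var (Pos v) = v"
| "lit_var (Neg v) = v"

definition is_clause :: "'v lit set \<Rightarrow> bool" where
  "is_clause C \<longleftrightarrow> finite C \<and> (\<forall>x\<in>C. compl x \<notin> C)"

definition is_clause_set :: "'v lit set set \<Rightarrow> bool" where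
  "is_clause_set F \<longleftrightarrow> finite F \<and> (\<forall>C\<in>F. is_clause C)"

definition clause_vars :: "'v lit set \<Rightarrow> 'v set" where
  "clause_vars C = lit_var ` C"

definition vars :: "'v lit set set \<Rightarrow> 'v set" where
  "vars F = (\<Union>C\<in>F. clause_vars C)"

definition deficiency :: "'v lit set set \<Rightarrow> int" where
  "deficiency F = int (card F) - int (card (vars F))"

definition satisfiable :: "'v lit set set \<Rightarrow> bool" where
  "satisfiable F \<longleftrightarrow> (\<exists>C. is_clause C \<and> (\<forall>D\<in>F. C \<inter> D \<noteq> {}))"

definition MU :: "'v lit set set set" where
  "MU = {F. is_clause_set F \<and> \<not> satisfiable F \<and> (\<forall>G. G \<subset> F \<longrightarrow> satisfiable G)}"

definition UHIT :: "'v lit set set set" where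
  "UHIT = {F. is_clause_set F \<and> \<not> satisfiable F \<and>
              (\<forall>C\<in>F. \<forall>D\<in>F. C \<noteq> D \<longrightarrow> (\<exists>x\<in>C. compl x \<in> D))}"

definition fc :: "'v lit set set \<Rightarrow> nat" where
  "fc F = card {C \<in> F. clause_vars C = vars F}"

definition var_degree :: "'v lit set set \<Rightarrow> 'v \<Rightarrow> nat" where
  "var_degree F v = card {C \<in> F. v \<in> clause_vars C}"

text \<open>Meaningful only for \<open>vars F \<noteq> {}\<close>.\<close>

definition min_var_degree :: "'v lit set set \<Rightarrow> nat" where
  "min_var_degree F = Min (var_degree F ` vars F)"

text \<open>
  The quantities carry the type of variables as an explicit argument. \<^const>\<open>Max\<close> is
  unspecified on empty and on infinite sets, so evaluating one of them includes showing that the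
  maximum exists. Since \<open>{{}}\<close> has deficiency 1, the condition \<open>F \<noteq> {{}}\<close> matters for
  \<open>k = 1\<close> only.
\<close>

definition FCH :: "'v::infinite itself \<Rightarrow> nat \<Rightarrow> nat" where
  "FCH _ k = Max {fc F | F :: 'v lit set set. F \<in> UHIT \<and> deficiency F = int k}"

definition FCM :: "'v::infinite itself \<Rightarrow> nat \<Rightarrow> nat" where
  "FCM _ k = Max {fc F | F :: 'v lit set set. F \<in> MU \<and> deficiency F = int k}"

definition VDH :: "'v::infinite itself \<Rightarrow> nat \<Rightarrow> nat" where
  "VDH _ k = Max {min_var_degree F | F :: 'v lit set set.
                    F \<in> UHIT \<and> deficiency F = int k \<and> F \<noteq> {{}}}"

definition VDM :: "'v::infinite itself \<Rightarrow> nat \<Rightarrow> nat" where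
  "VDM _ k = Max {min_var_degree F | F :: 'v lit set set.
                    F \<in> MU \<and> deficiency F = int k \<and> F \<noteq> {{}}}"

text \<open>
  The sequences are indexed from 1, whereas \<^const>\<open>enumerate\<close> counts from 0; their values
  at 0 are irrelevant.
\<close>

definition S2 :: "nat \<Rightarrow> nat" where
  "S2 k = (LEAST n. (2::nat) ^ k dvd fact n)"

definition nM :: "nat \<Rightarrow> nat" where
  "nM k = enumerate {m. m \<ge> 1 \<and> \<not> (\<exists>n\<ge>1. m = 2 ^ n - 1)} (k - 1)"

definition nM1 :: "nat \<Rightarrow> nat" where
  "nM1 k = (if \<exists>n\<ge>3. k = 2 ^ n - n + 1 then nM k - 1 else nM k)"

end

theory Submission imports Defs begin

text \<open>
  Upper bounds. Take a saturated minimally unsatisfiable clause-set of deficiency \<open>k\<close> and a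
  variable of minimal degree, \<open>e + e'\<close>. Satisfying the literal that occurs \<open>e\<close> times leaves a
  minimally unsatisfiable clause-set of deficiency \<open>k - e + 1\<close>, which by induction has a variable
  of low degree; this gives a recursive bound on \<open>e'\<close>. Using both literals the recursion yields the
  values of \<open>nM1\<close>, except that for \<open>k = 6\<close> it gives 9 instead of 8, where a closer look at
  the splittings, of deficiency 2 and 3, is needed. If the number of full clauses reaches the
  minimal degree, some variable occurs only in full clauses, which then come in pairs.

  Lower bounds. Splitting \<open>r\<close> full clauses on a new variable turns deficiency \<open>k\<close> into
  \<open>k + r - 1\<close> and produces \<open>2 r\<close> full clauses. The remaining values are realised by small
  covers of the cubes of dimension 3 and 4.
\<close>

section \<open>Minimally unsatisfiable families of partial assignments\<close>

text \<open>Assigning a variable preserves minimality only if every clause free of that variable has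
  a private falsifying assignment on the chosen side. Saturation supplies it; as it only adds
  literals, degrees only rise, so a bound for the saturated family also holds for the original one.
  In deficiency 6 the recursion leaves a single pattern above 8, namely 5 + 4. Both of its
  splittings must attain their bounds 4 and 5 exactly, so a variable of low degree in a splitting
  occurs in all clauses lost there. The side of deficiency 2 is understood by splitting again: in
  deficiency 1 two clauses clash at most once, which leaves only one variable of degree 2 and forces
  a unit clause. The short clauses obtained in this way carry the contradiction. The value 8 at 6 is
  in turn what excludes 9 + 8 at 13. Pairing of full clauses rules out odd values of the degree
  bound. At 7, where the bound is 10, five full clauses would pass to a splitting of deficiency 3,
  whose bound 5 is odd. In the hitting case the remaining 9 falls to parity.\<close>

text \<open>A clause is represented by the least partial assignment falsifying it, and a clause-set by an
  indexed family, so that saturation and splitting keep the index set under control. The set \<open>V\<close>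
  may contain variables that do not occur, so vanishing variables need no attention: they have
  degree 0.\<close>

definition falsifies :: "('v \<Rightarrow> bool) \<Rightarrow> ('v \<Rightarrow> bool option) \<Rightarrow> bool" where
  "falsifies f p \<longleftrightarrow> (\<forall>x b. p x = Some b \<longrightarrow> f x = b)"

definition only_falsifies :: "'i set \<Rightarrow> ('i \<Rightarrow> 'v \<Rightarrow> bool option) \<Rightarrow> 'i \<Rightarrow> ('v \<Rightarrow> bool) \<Rightarrow> bool" where
  "only_falsifies I c i f \<longleftrightarrow> falsifies f (c i) \<and> (\<forall>j\<in>I. falsifies f (c j) \<longrightarrow> j = i)"

definition mu :: "'i set \<Rightarrow> 'v set \<Rightarrow> ('i \<Rightarrow> 'v \<Rightarrow> bool option) \<Rightarrow> bool" where
  "mu I V c \<longleftrightarrow> finite I \<and> finite V \<and> (\<forall>i\<in>I. dom (c i) \<subseteq> V) \<and>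
     (\<forall>f. \<exists>i\<in>I. falsifies f (c i)) \<and> (\<forall>i\<in>I. \<exists>f. only_falsifies I c i f)"

text \<open>The usual condition, that no literal can be added, in terms of witnesses: a literal on
  \<open>x\<close> added to clause \<open>i\<close> keeps only one value of \<open>x\<close>, so a
  private assignment with the other value would become satisfying.\<close>

definition saturated :: "'i set \<Rightarrow> 'v set \<Rightarrow> ('i \<Rightarrow> 'v \<Rightarrow> bool option) \<Rightarrow> bool" where
  "saturated I V c \<longleftrightarrow>
     (\<forall>i\<in>I. \<forall>x\<in>V. \<forall>b. c i x = None \<longrightarrow> (\<exists>f. only_falsifies I c i f \<and> f x = b))"

definition occ :: "'i set \<Rightarrow> ('i \<Rightarrow> 'v \<Rightarrow> bool option) \<Rightarrow> 'v \<Rightarrow> bool \<Rightarrow> nat" where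
  "occ I c x b = card {i\<in>I. c i x = Some b}"

definition deg :: "'i set \<Rightarrow> ('i \<Rightarrow> 'v \<Rightarrow> bool option) \<Rightarrow> 'v \<Rightarrow> nat" where
  "deg I c x = card {i\<in>I. c i x \<noteq> None}"

text \<open>The clauses left when \<open>x\<close> receives the value \<open>\<not> b\<close>: those
  with \<open>Some b\<close> can be falsified only at \<open>b\<close>, so they are
  satisfied.\<close>

definition rest :: "'i set \<Rightarrow> ('i \<Rightarrow> 'v \<Rightarrow> bool option) \<Rightarrow> 'v \<Rightarrow> bool \<Rightarrow> 'i set" where
  "rest I c x b = {i\<in>I. c i x \<noteq> Some b}"

definition strip :: "('i \<Rightarrow> 'v \<Rightarrow> bool option) \<Rightarrow> 'v \<Rightarrow> 'i \<Rightarrow> 'v \<Rightarrow> bool option" where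
  "strip c x i = (c i)(x := None)"

text \<open>All deficiencies up to \<open>k\<close> are covered at once. The premise
  \<open>V \<noteq> {}\<close> excludes the family made of the empty clause; for
  \<open>k = 0\<close> it is automatic, as \<open>I\<close> is never empty.\<close>

definition bounded :: "('i \<times> 'v) itself \<Rightarrow> nat \<Rightarrow> nat \<Rightarrow> bool" where
  "bounded _ k b \<longleftrightarrow> (\<forall>(I :: 'i set) (V :: 'v set) c.
     mu I V c \<longrightarrow> V \<noteq> {} \<or> k = 0 \<longrightarrow> card I \<le> card V + k \<longrightarrow> (\<exists>x\<in>V. deg I c x \<le> b))"

lemma boundedD:
  assumes "bounded TYPE('i \<times> 'v) k b" "mu (I :: 'i set) (V :: 'v set) c" "V \<noteq> {} \<or> k = 0"
    "card I \<le> card V + k"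
  shows "\<exists>x\<in>V. deg I c x \<le> b"
  using assms unfolding bounded_def by blast

lemma muD:
  assumes "mu I V c"
  shows "finite I" "finite V" "\<And>i. i \<in> I \<Longrightarrow> dom (c i) \<subseteq> V"
    "\<And>f. \<exists>i\<in>I. falsifies f (c i)" "\<And>i. i \<in> I \<Longrightarrow> \<exists>f. only_falsifies I c i f"
  using assms unfolding mu_def by blast+

lemma falsifiesD: "falsifies f p \<Longrightarrow> p x = Some b \<Longrightarrow> f x = b"
  by (simp add: falsifies_def)

section \<open>Counting occurrences across a splitting\<close>

lemma deg_eq_occ: "finite I \<Longrightarrow> deg I c x = occ I c x b + occ I c x (\<not> b)"
proof -
  assume fin: "finite I"
  have "{i\<in>I. c i x \<noteq> None} = {i\<in>I. c i x = Some b} \<union> {i\<in>I. c i x = Some (\<not> b)}"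
    by (auto; metis (full_types))
  then show ?thesis
    unfolding deg_def occ_def using fin by (simp, subst card_Un_disjoint) auto
qed

lemma card_rest: "finite I \<Longrightarrow> card (rest I c x b) + occ I c x b = card I"
proof -
  assume fin: "finite I"
  have "I = rest I c x b \<union> {i\<in>I. c i x = Some b}" "rest I c x b \<inter> {i\<in>I. c i x = Some b} = {}"
    unfolding rest_def by auto
  then show ?thesis
    unfolding occ_def using fin by (metis (no_types, lifting) card_Un_disjoint finite_Un)
qed

lemma deg_rest:
  "finite I \<Longrightarrow> deg I c y = deg (rest I c x b) c y + card {i\<in>I. c i x = Some b \<and> c i y \<noteq> None}"
proof -
  assume fin: "finite I"
  have "{i\<in>I. c i y \<noteq> None} = {i\<in>rest I c x b. c i y \<noteq> None} \<union> {i\<in>I. c i x = Some b \<and> c i y \<noteq> None}"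
    unfolding rest_def by auto
  then show ?thesis
    unfolding deg_def using fin by (simp, subst card_Un_disjoint) (auto simp: rest_def)
qed

lemma deg_rest_le: "finite I \<Longrightarrow> deg I c y \<le> deg (rest I c x b) c y + occ I c x b"
  by (subst deg_rest[where x=x and b=b], assumption)
     (auto simp: occ_def intro!: card_mono)

lemma deg_strip: "y \<noteq> x \<Longrightarrow> deg I (strip c x) y = deg I c y"
  by (simp add: deg_def strip_def)

lemma finite_rest: "finite I \<Longrightarrow> finite (rest I c x b)"
  by (simp add: rest_def)

section \<open>Splitting, unit propagation and saturation\<close>

lemma mu_nonempty: "mu I V c \<Longrightarrow> I \<noteq> {}"
  using muD(4) by fastforce

lemma mu_subsume:
  assumes "mu I V c" "i \<in> I" "j \<in> I" "c i \<subseteq>\<^sub>m c j"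
  shows "i = j"
proof -
  obtain f where f: "only_falsifies I c j f" using muD(5)[OF assms(1,3)] by blast
  have "falsifies f (c i)"
    using f assms(4) unfolding only_falsifies_def falsifies_def map_le_def by (metis domI)
  then show ?thesis using f assms(2) unfolding only_falsifies_def by blast
qed

text \<open>The private assignment of a surviving clause has to respect the value given to
  \<open>x\<close>. For clauses containing \<open>x\<close> it does so automatically;
  \<open>sat\<close> provides it for the others.\<close>

lemma mu_split:
  assumes mu: "mu I V c" and x: "x \<in> V"
    and sat: "\<And>i. i \<in> I \<Longrightarrow> c i x = None \<Longrightarrow> \<exists>f. only_falsifies I c i f \<and> f x = (\<not> b)"
  shows "mu (rest I c x b) (V - {x}) (strip c x)"
  unfolding mu_def
proof (intro conjI allI ballI)
  show "finite (rest I c x b)" "finite (V - {x})"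
    using muD(1,2)[OF mu] by (auto simp: rest_def)
  fix i assume i: "i \<in> rest I c x b"
  then have iI: "i \<in> I" and ib: "c i x \<noteq> Some b" by (auto simp: rest_def)
  show "dom (strip c x i) \<subseteq> V - {x}" using muD(3)[OF mu iI] by (auto simp: strip_def)
  obtain f where f: "only_falsifies I c i f" "f x = (\<not> b)"
  proof (cases "c i x")
    case None
    from sat[OF iI None] that show ?thesis by blast
  next
    case (Some d)
    obtain f where f: "only_falsifies I c i f" using muD(5)[OF mu iI] by blast
    then have "f x = d" using Some by (auto simp: only_falsifies_def falsifies_def)
    then show ?thesis using f ib Some that by auto
  qed
  have "only_falsifies (rest I c x b) (strip c x) i f"
    unfolding only_falsifies_def
  proof (intro conjI ballI impI)
    show "falsifies f (strip c x i)"
      using f(1) by (auto simp: only_falsifies_def falsifies_def strip_def split: if_splits)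
    fix j assume j: "j \<in> rest I c x b" "falsifies f (strip c x j)"
    have "falsifies f (c j)"
      unfolding falsifies_def
    proof (intro allI impI)
      fix y d assume y: "c j y = Some d"
      show "f y = d"
      proof (cases "y = x")
        case True
        then show ?thesis using y f(2) j(1) by (auto simp: rest_def)
      next
        case False
        then show ?thesis using y j(2) by (auto simp: falsifies_def strip_def)
      qed
    qed
    then show "j = i" using f(1) j(1) by (auto simp: only_falsifies_def rest_def)
  qed
  then show "\<exists>f. only_falsifies (rest I c x b) (strip c x) i f" by blast
next
  fix f
  obtain i where i: "i \<in> I" "falsifies (f(x := \<not> b)) (c i)" using muD(4)[OF mu] by blast
  then have "i \<in> rest I c x b" "falsifies f (strip c x i)"
    by (auto simp: rest_def falsifies_def strip_def split: if_splits)
  then show "\<exists>i\<in>rest I c x b. falsifies f (strip c x i)" by blast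
qed

lemma saturated_split:
  assumes "mu I V c" "saturated I V c" "x \<in> V"
  shows "mu (rest I c x b) (V - {x}) (strip c x)"
  using assms by (intro mu_split) (auto simp: saturated_def)

text \<open>A private assignment of any other clause satisfies the unit clause, hence already gives
  \<open>y\<close> the value \<open>\<not> b\<close>, which is the side condition of
  \<open>mu_split\<close>. By subsumption only \<open>i\<close> is lost, so the deficiency does not
  change.\<close>

lemma mu_unit_propagation:
  assumes mu: "mu I V c" and i: "i \<in> I" "c i = [y \<mapsto> b]"
  shows "mu (I - {i}) (V - {y}) (strip c y)" "rest I c y b = I - {i}"
proof -
  show r: "rest I c y b = I - {i}"
  proof -
    have "j = i" if "j \<in> I" "c j y = Some b" for j
      using mu_subsume[OF mu i(1) that(1)] that(2) by (simp add: i(2) map_le_def)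
    moreover have "c i y = Some b" by (simp add: i(2))
    ultimately show ?thesis using i(1) unfolding rest_def by blast
  qed
  have y: "y \<in> V" using muD(3)[OF mu i(1)] i(2) by auto
  have "mu (rest I c y b) (V - {y}) (strip c y)"
  proof (rule mu_split[OF mu y])
    fix j assume j: "j \<in> I" "c j y = None"
    then obtain f where f: "only_falsifies I c j f" using muD(5)[OF mu] by blast
    have "\<not> falsifies f (c i)"
      using f i(1) j(2) unfolding only_falsifies_def by (metis fun_upd_same i(2) option.distinct(1))
    then have "f y = (\<not> b)" by (auto simp: falsifies_def i(2) split: if_splits)
    then show "\<exists>f. only_falsifies I c j f \<and> f y = (\<not> b)" using f by blast
  qed
  then show "mu (I - {i}) (V - {y}) (strip c y)" by (simp add: r)
qed

lemma exists_saturation: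
  assumes "mu I V c"
  obtains c' where "mu I V c'" "saturated I V c'" "\<forall>i\<in>I. c i \<subseteq>\<^sub>m c' i"
proof -
  have "\<exists>c'. mu I V c' \<and> saturated I V c' \<and> (\<forall>i\<in>I. c i \<subseteq>\<^sub>m c' i)"
    using assms
  proof (induction "\<Sum>i\<in>I. card (V - dom (c i))" arbitrary: c rule: less_induct)
    case less
    show ?case
    proof (cases "saturated I V c")
      case True
      then show ?thesis using less.prems by auto
    next
      case False
      then obtain i x b where i: "i \<in> I" "x \<in> V" "c i x = None"
        and nf: "\<And>f. only_falsifies I c i f \<Longrightarrow> f x = (\<not> b)"
        unfolding saturated_def by auto
      \<comment> \<open>All private assignments of \<open>i\<close> agree at \<open>x\<close>, so
        putting this value into the clause uncovers no assignment, and the number of missing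
        literals falls.\<close>
      define c' where "c' = c(i := (c i)(x \<mapsto> \<not> b))"
      have le: "c j \<subseteq>\<^sub>m c' j" for j using i by (auto simp: c'_def map_le_def)
      have fals: "falsifies f (c' j) \<Longrightarrow> falsifies f (c j)" for f j
        using le[of j] unfolding falsifies_def map_le_def by (metis domI)
      have key: "falsifies f (c' i)" if "only_falsifies I c i f" for f
        using that nf[OF that] by (auto simp: only_falsifies_def falsifies_def c'_def)
      have mu': "mu I V c'"
        unfolding mu_def
      proof (intro conjI allI ballI)
        show "finite I" "finite V" using muD[OF less.prems] by auto
        show "dom (c' j) \<subseteq> V" if "j \<in> I" for j
          using muD(3)[OF less.prems that] i by (auto simp: c'_def)
        show "\<exists>j\<in>I. falsifies f (c' j)" for f
        proof (cases "\<exists>j\<in>I. j \<noteq> i \<and> falsifies f (c j)")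
          case True
          then show ?thesis by (auto simp: c'_def)
        next
          case False
          then have "only_falsifies I c i f"
            using muD(4)[OF less.prems, of f] unfolding only_falsifies_def by metis
          then show ?thesis using key i by blast
        qed
        show "\<exists>f. only_falsifies I c' j f" if j: "j \<in> I" for j
        proof -
          obtain f where f: "only_falsifies I c j f" using muD(5)[OF less.prems j] by blast
          have "falsifies f (c' j)"
            using f key by (cases "j = i") (auto simp: only_falsifies_def c'_def)
          then show ?thesis using f fals unfolding only_falsifies_def by blast
        qed
      qed
      have "card (V - dom (c' i)) < card (V - dom (c i))"
        using i muD(2)[OF less.prems] by (intro psubset_card_mono) (auto simp: c'_def)
      moreover have "card (V - dom (c' j)) \<le> card (V - dom (c j))" for j
        using muD(2)[OF less.prems] by (intro card_mono) (auto simp: c'_def)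
      ultimately have "(\<Sum>i\<in>I. card (V - dom (c' i))) < (\<Sum>i\<in>I. card (V - dom (c i)))"
        using i(1) muD(1)[OF less.prems] by (intro sum_strict_mono_ex1) auto
      from less.hyps[OF this mu'] obtain c'' where
        "mu I V c''" "saturated I V c''" "\<forall>i\<in>I. c' i \<subseteq>\<^sub>m c'' i" by blast
      then show ?thesis using le by (meson map_le_trans)
    qed
  qed
  then show ?thesis using that by blast
qed

lemma map_le_not_None: "p \<subseteq>\<^sub>m q \<Longrightarrow> p x \<noteq> None \<Longrightarrow> q x = p x"
  by (metis domIff map_le_def)

lemma deg_mono:
  assumes "finite I" "\<forall>i\<in>I. c i \<subseteq>\<^sub>m c' i"
  shows "deg I c x \<le> deg I c' x"
  unfolding deg_def using assms map_le_not_None by (intro card_mono) (auto, fastforce)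

lemma occ_mono:
  assumes "finite I" "\<forall>i\<in>I. c i \<subseteq>\<^sub>m c' i"
  shows "occ I c x b \<le> occ I c' x b"
  unfolding occ_def
  using assms map_le_not_None by (intro card_mono) (auto, fastforce)

text \<open>Flip \<open>x\<close> in a private assignment of \<open>i\<close>. The clause falsified
  now must contain \<open>x\<close>, since otherwise it was falsified before the flip and would be
  \<open>i\<close>.\<close>

lemma mu_not_pure:
  assumes mu: "mu I V c" and i: "i \<in> I" "c i x = Some b"
  shows "occ I c x (\<not> b) \<ge> 1"
proof -
  obtain f where f: "only_falsifies I c i f" using muD(5)[OF mu i(1)] by blast
  obtain j where j: "j \<in> I" "falsifies (f(x := \<not> b)) (c j)" using muD(4)[OF mu] by blast
  have "c j x = Some (\<not> b)"
  proof (cases "c j x")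
    case None
    then have "falsifies f (c j)" using j unfolding falsifies_def
      by (metis fun_upd_other option.distinct(1))
    then have "j = i" using f j by (auto simp: only_falsifies_def)
    then show ?thesis using None i by simp
  next
    case (Some d)
    then have "(f(x := \<not> b)) x = d" using j(2) unfolding falsifies_def by blast
    then show ?thesis using Some by simp
  qed
  then show ?thesis using j muD(1)[OF mu]
    by (auto simp: occ_def Suc_le_eq card_gt_0_iff)
qed

lemma mu_occ_pos:
  assumes mu: "mu I V c" and d: "deg I c x \<ge> 1"
  shows "occ I c x b \<ge> 1"
proof -
  have "{i\<in>I. c i x \<noteq> None} \<noteq> {}" using d unfolding deg_def by (metis card.empty not_one_le_zero)
  then obtain i d where i: "i \<in> I" "c i x = Some d" by auto
  show ?thesis
  proof (cases "d = b")
    case True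
    then show ?thesis using i muD(1)[OF mu] by (auto simp: occ_def Suc_le_eq card_gt_0_iff)
  next
    case False
    then have "b = (\<not> d)" by auto
    then show ?thesis using mu_not_pure[OF mu i] by simp
  qed
qed

section \<open>Recursive bounds on the minimal degree\<close>

lemma split_low:
  assumes B: "bounded TYPE('i \<times> 'v) k b"
    and mu: "mu (I :: 'i set) (V :: 'v set) c" "saturated I V c" and x: "x \<in> V"
    and ne: "V \<noteq> {x} \<or> k = 0" and card: "card I + 1 \<le> card V + k + occ I c x s"
  obtains y where "y \<in> V" "y \<noteq> x" "deg (rest I c x s) c y \<le> b"
proof -
  have "card (rest I c x s) + occ I c x s = card I" using card_rest[OF muD(1)[OF mu(1)]] .
  moreover have "card V = card (V - {x}) + 1" using card.remove[OF muD(2)[OF mu(1)] x] by simp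
  ultimately have "card (rest I c x s) \<le> card (V - {x}) + k" using card by linarith
  from boundedD[OF B saturated_split[OF mu x] _ this] ne x obtain y
    where "y \<in> V - {x}" "deg (rest I c x s) (strip c x) y \<le> b" by blast
  then show ?thesis using that by (auto simp: deg_strip)
qed

lemma ex_min_deg:
  assumes "finite V" "V \<noteq> {}"
  shows "\<exists>x\<in>V. \<forall>y\<in>V. deg I c x \<le> deg I c y"
  using ex_is_arg_min_if_finite[OF assms, of "deg I c"] by (auto simp: is_arg_min_linorder)

text \<open>Tarsi's lemma. Splitting on a variable of minimal degree loses at least one clause along
  with the variable, so by induction some \<open>y\<close> occurs only in lost clauses; as the
  opposite literal also occurs, these are fewer than the minimal degree.\<close>

lemma tarsi: "bounded TYPE('i \<times> 'v) 0 0"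
proof -
  have "\<exists>x\<in>V. deg I c x = 0" if "mu I V c" "card I \<le> card V" for I :: "'i set" and V :: "'v set" and c
    using that
  proof (induction "card V" arbitrary: I V c rule: less_induct)
    case less
    have fin: "finite I" "finite V" using muD[OF less.prems(1)] by auto
    show ?case
    proof (rule ccontr)
      assume neg: "\<not> ?thesis"
      have "V \<noteq> {}" using less.prems mu_nonempty fin by fastforce
      obtain c' where c': "mu I V c'" "saturated I V c'" "\<forall>i\<in>I. c i \<subseteq>\<^sub>m c' i"
        using exists_saturation[OF less.prems(1)] .
      obtain x where x: "x \<in> V" "\<forall>y\<in>V. deg I c' x \<le> deg I c' y"
        using ex_min_deg[OF fin(2) \<open>V \<noteq> {}\<close>] by blast
      have "deg I c' x \<ge> 1"
        using neg deg_mono[OF fin(1) c'(3), of x] x(1) by fastforce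
      then have o: "occ I c' x b \<ge> 1" for b using mu_occ_pos[OF c'(1)] by blast
      have "card (rest I c' x True) + occ I c' x True = card I" using card_rest[OF fin(1)] .
      moreover have V: "card (V - {x}) < card V" "card V = card (V - {x}) + 1"
        using card.remove[OF fin(2) x(1)] by auto
      ultimately have "card (rest I c' x True) \<le> card (V - {x})"
        using o[of True] less.prems(2) by linarith
      from less.hyps[OF V(1) saturated_split[OF c'(1,2) x(1)] this]
      obtain y where y: "y \<in> V - {x}" "deg (rest I c' x True) c' y = 0" by (auto simp: deg_strip)
      then have "deg I c' y \<le> occ I c' x True" using deg_rest_le[OF fin(1), of c' y x True] by simp
      then show False
        using bspec[OF x(2), of y] y deg_eq_occ[OF fin(1), of c' x True] o[of False] by simp
    qed
  qed
  then show ?thesis unfolding bounded_def by fastforce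
qed

lemma single_var_deg:
  assumes mu: "mu I {x} c"
  shows "deg I c x \<le> 2"
proof -
  have "occ I c x b \<le> 1" for b
  proof -
    have "i = j" if "i \<in> I" "j \<in> I" "c i x = Some b" "c j x = Some b" for i j
    proof (rule mu_subsume[OF mu that(1,2)])
      have "dom (c i) \<subseteq> {x}" using muD(3)[OF mu that(1)] .
      then show "c i \<subseteq>\<^sub>m c j" using that(3,4) by (auto simp: map_le_def)
    qed
    then show ?thesis using muD(1)[OF mu] by (auto simp: occ_def card_le_Suc0_iff_eq)
  qed
  then show ?thesis using deg_eq_occ[of I c x True] muD(1)[OF mu]
    by (metis add_mono one_add_one)
qed

text \<open>A variable of degree at most \<open>b\<close> in the splitting regains at most
  \<open>occ I c x s\<close> occurrences in \<open>I\<close>. Minimality of the degree of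
  \<open>x\<close> then leaves at most \<open>b\<close> for the other literal.\<close>

lemma min_deg_occ_le:
  assumes B: "bounded TYPE('i \<times> 'v) k' b"
    and mu: "mu (I :: 'i set) (V :: 'v set) c" "saturated I V c" and x: "x \<in> V"
    and min: "\<forall>y\<in>V. deg I c x \<le> deg I c y"
    and ne: "V \<noteq> {x} \<or> k' = 0" and card: "card I \<le> card V + k" "k + 1 \<le> k' + occ I c x s"
  shows "occ I c x (\<not> s) \<le> b"
proof -
  have fin: "finite I" using muD[OF mu(1)] by auto
  from card have "card I + 1 \<le> card V + k' + occ I c x s" by simp
  from split_low[OF B mu x ne this] obtain y where
    "y \<in> V" "deg (rest I c x s) c y \<le> b" .
  then show ?thesis
    using bspec[OF min, of y] deg_rest_le[OF fin, of c y x s] deg_eq_occ[OF fin, of c x s] by linarith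
qed

text \<open>Turns the recursion into arithmetic: \<open>e\<close> and \<open>e'\<close> count the
  rarer and the more frequent literal, and each implication comes from satisfying one of them. The
  premise \<open>b \<ge> 2\<close> handles a single variable.\<close>

lemma bounded_step:
  assumes B: "\<And>j. j < k \<Longrightarrow> bounded TYPE('i \<times> 'v) j (B j)"
    and b: "b \<ge> 2" and k: "k > 0"
    and arith: "\<And>e e'. 1 \<le> e \<Longrightarrow> e \<le> e' \<Longrightarrow> (\<And>j. j < k \<Longrightarrow> k + 1 \<le> j + e' \<Longrightarrow> e \<le> B j) \<Longrightarrow>
      (\<And>j. j < k \<Longrightarrow> k + 1 \<le> j + e \<Longrightarrow> e' \<le> B j) \<Longrightarrow> e + e' \<le> b"
  shows "bounded TYPE('i \<times> 'v) k b"
  unfolding bounded_def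
proof (intro allI impI)
  fix I :: "'i set" and V :: "'v set" and c
  assume mu: "mu I V c" and ne: "V \<noteq> {} \<or> k = 0" and card: "card I \<le> card V + k"
  have fin: "finite I" "finite V" using muD[OF mu] by auto
  obtain c' where c': "mu I V c'" "saturated I V c'" "\<forall>i\<in>I. c i \<subseteq>\<^sub>m c' i"
    using exists_saturation[OF mu] .
  have "V \<noteq> {}" using ne k by simp
  obtain x where x: "x \<in> V" "\<forall>y\<in>V. deg I c' x \<le> deg I c' y"
    using ex_min_deg[OF fin(2) \<open>V \<noteq> {}\<close>] by blast
  have "deg I c' x \<le> b"
  proof (cases "V = {x} \<or> deg I c' x = 0")
    case True
    then show ?thesis using single_var_deg[of I x c'] c'(1) b by auto
  next
    case False
    have le: "occ I c' x (\<not> s) \<le> B j" if "j < k" "k + 1 \<le> j + occ I c' x s" for s j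
      using min_deg_occ_le[OF B[OF that(1)] c'(1,2) x _ card that(2)] False by blast
    have pos: "occ I c' x s \<ge> 1" for s using mu_occ_pos[OF c'(1)] False by (simp add: Suc_le_eq)
    have "occ I c' x True + occ I c' x False \<le> b"
    proof (cases "occ I c' x True \<le> occ I c' x False")
      case True
      then show ?thesis using arith[OF pos True] le[of _ True] le[of _ False] by simp
    next
      case False
      then show ?thesis using arith[of "occ I c' x False" "occ I c' x True"] pos
          le[of _ True] le[of _ False] by (simp add: add.commute)
    qed
    then show ?thesis using deg_eq_occ[OF fin(1), of c' x True] by simp
  qed
  then show "\<exists>x\<in>V. deg I c x \<le> b" using x(1) deg_mono[OF fin(1) c'(3), of x] by (meson order_trans)
qed

text \<open>The values of \<open>nM1\<close> from 1 to 13, with Tarsi's bound at position 0.\<close>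

definition vdm_bound :: "nat \<Rightarrow> nat" where
  "vdm_bound k = [0, 2, 4, 5, 6, 8, 8, 10, 11, 12, 13, 14, 16, 16] ! k"

lemma vdm_bound_simps [simp]:
  "vdm_bound 0 = 0" "vdm_bound (Suc 0) = 2" "vdm_bound 2 = 4" "vdm_bound 3 = 5"
  "vdm_bound 4 = 6" "vdm_bound 5 = 8" "vdm_bound 6 = 8" "vdm_bound 7 = 10" "vdm_bound 8 = 11"
  "vdm_bound 9 = 12" "vdm_bound 10 = 13" "vdm_bound 11 = 14" "vdm_bound 12 = 16"
  "vdm_bound 13 = 16"
  by (simp_all add: vdm_bound_def)

lemma bounded_le_5:
  assumes "k \<le> 5"
  shows "bounded TYPE('i \<times> 'v) k (vdm_bound k)"
  using assms
proof (induction k rule: less_induct)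
  case (less k)
  show ?case
  proof (cases "k = 0")
    case True
    then show ?thesis using tarsi by simp
  next
    case False
    then consider "k = 1" | "k = 2" | "k = 3" | "k = 4" | "k = 5" using less.prems by linarith
    note k = this
    show ?thesis
    proof (rule bounded_step[where B = vdm_bound])
      from k show "vdm_bound k \<ge> 2" by cases auto
    next
      fix e e' :: nat
      assume e: "1 \<le> e" "e \<le> e'"
        and *: "\<And>j. j < k \<Longrightarrow> k + 1 \<le> j + e' \<Longrightarrow> e \<le> vdm_bound j"
      have *: "j < k \<longrightarrow> k + 1 \<le> j + e' \<longrightarrow> e \<le> vdm_bound j" for j using * by blast
      \<comment> \<open>Deficiency 0 yields \<open>e' \<le> k\<close>; for \<open>k \<ge> 2\<close>,
        deficiency 1 yields \<open>e \<le> 2\<close> when \<open>e' = k\<close>. Up to 5 this is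
        enough.\<close>
      from k show "e + e' \<le> vdm_bound k"
        using e *[of 0] *[of 1] by cases (simp_all, presburger+)
    qed (use less False in auto)
  qed
qed

text \<open>Deficiency 6 enters as an assumption because there the recursion alone still admits
  \<open>e = 4\<close>, \<open>e' = 5\<close>.\<close>

lemma bounded_le_13:
  assumes six: "bounded TYPE('i \<times> 'v) 6 8" and "k \<le> 13"
  shows "bounded TYPE('i \<times> 'v) k (vdm_bound k)"
  using assms(2)
proof (induction k rule: less_induct)
  case (less k)
  show ?case
  proof (cases "k \<le> 6")
    case True
    then show ?thesis using bounded_le_5[of k] six by (cases "k = 6") auto
  next
    case False
    then consider "k = 7" | "k = 8" | "k = 9" | "k = 10" | "k = 11" | "k = 12" | "k = 13"
      using less.prems by linarith
    note k = this
    show ?thesis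
    proof (rule bounded_step[where B = vdm_bound])
      from k show "vdm_bound k \<ge> 2" by cases auto
    next
      fix e e' :: nat
      assume e: "1 \<le> e" "e \<le> e'"
        and *: "\<And>j. j < k \<Longrightarrow> k + 1 \<le> j + e' \<Longrightarrow> e \<le> vdm_bound j"
        and **: "\<And>j. j < k \<Longrightarrow> k + 1 \<le> j + e \<Longrightarrow> e' \<le> vdm_bound j"
      have *: "j < k \<longrightarrow> k + 1 \<le> j + e' \<longrightarrow> e \<le> vdm_bound j" for j using * by blast
      have **: "j < k \<longrightarrow> k + 1 \<le> j + e \<longrightarrow> e' \<le> vdm_bound j" for j using ** by blast
      \<comment> \<open>The instance \<open>**[of 6]\<close> serves \<open>k = 13\<close>: the other
        conditions leave one pattern beyond 16, \<open>e = 8\<close> with \<open>e' = 9\<close>, and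
        the bound 8 for deficiency 6 excludes it.\<close>
      from k show "e + e' \<le> vdm_bound k"
        using e *[of 0] *[of 1] *[of 2] *[of 3] *[of 4] *[of 5] **[of 6]
        by cases (simp_all, presburger+)
    qed (use less False in auto)
  qed
qed

lemma bounded_1: "bounded TYPE('i \<times> 'v) 1 2"
  using bounded_le_5[of 1] by simp

section \<open>Deficiency 1\<close>

definition used :: "'i set \<Rightarrow> 'v set \<Rightarrow> ('i \<Rightarrow> 'v \<Rightarrow> bool option) \<Rightarrow> bool" where
  "used I V c \<longleftrightarrow> (\<forall>x\<in>V. \<exists>i\<in>I. c i x \<noteq> None)"

lemma used_iff_deg: "finite I \<Longrightarrow> used I V c \<longleftrightarrow> (\<forall>x\<in>V. deg I c x \<ge> 1)"
  unfolding used_def deg_def Suc_le_eq One_nat_def card_gt_0_iff by (auto simp del: not_None_eq; blast)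

lemma used_mono: "used I V c \<Longrightarrow> \<forall>i\<in>I. c i \<subseteq>\<^sub>m c' i \<Longrightarrow> used I V c'"
  unfolding used_def by (metis map_le_not_None)

text \<open>Since both signs occur, degree at most 2 means one clause of each sign. If the two
  differed at some \<open>y\<close>, flipping \<open>x\<close> in a suitable private assignment of
  one of them would falsify neither; a clause falsified instead is free of \<open>x\<close> and was
  falsified before the flip.\<close>

lemma contraction:
  assumes mu: "mu (I :: 'i set) (V :: 'v set) c" and sat: "saturated I V c" and used: "used I V c"
    and ne: "V \<noteq> {}" and card: "card I \<le> card V + 1"
  obtains x i j where "x \<in> V" "i \<in> I" "j \<in> I" "i \<noteq> j" "c i x = Some True" "c j x = Some False"
    "\<forall>k\<in>I. c k x \<noteq> None \<longrightarrow> k = i \<or> k = j" "\<forall>y. y \<noteq> x \<longrightarrow> c i y = c j y"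
    "deg I c x = 2"
proof -
  have fin: "finite I" "finite V" using muD[OF mu] by auto
  obtain x where x: "x \<in> V" "deg I c x \<le> 2" using boundedD[OF bounded_1 mu] ne card by blast
  have d: "deg I c x \<ge> 1" using used x fin by (simp add: used_iff_deg)
  have "occ I c x b \<ge> 1" for b using mu_occ_pos[OF mu d] .
  from this[of True] this[of False] have o: "occ I c x b = 1" for b
    using x(2) deg_eq_occ[OF fin(1), of c x True] by (cases b) auto
  then have deg2: "deg I c x = 2" using deg_eq_occ[OF fin(1), of c x True] by simp
  obtain i j where i: "{k\<in>I. c k x = Some True} = {i}" and j: "{k\<in>I. c k x = Some False} = {j}"
    using o[of True] o[of False] unfolding occ_def by (elim card_1_singletonE)
  have only: "k = (if b then i else j)" if "k \<in> I" "c k x = Some b" for k b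
    using i j that by (cases b) auto
  have ij: "i \<in> I" "j \<in> I" "c i x = Some True" "c j x = Some False" using i j by blast+
  have sub: "c l y = Some s" if y: "y \<noteq> x" "c k y = Some s"
    and kl: "k \<in> I" "l \<in> I" "c k x = Some b" "c l x = Some (\<not> b)" for k l b y s
  proof (rule ccontr)
    assume neg: "c l y \<noteq> Some s"
    have yV: "y \<in> V" using y(2) muD(3)[OF mu kl(1)] by auto
    obtain f where f: "only_falsifies I c l f" "f y = (\<not> s)"
    proof (cases "c l y")
      case None
      then show ?thesis using sat kl(2) yV that unfolding saturated_def by blast
    next
      case (Some d)
      obtain f where f: "only_falsifies I c l f" using muD(5)[OF mu kl(2)] by blast
      then have "f y = d" using Some by (auto simp: only_falsifies_def falsifies_def)
      then show ?thesis using f neg Some that by auto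
    qed
    obtain m where m: "m \<in> I" "falsifies (f(x := b)) (c m)" using muD(4)[OF mu] by blast
    have "c m x \<noteq> Some (\<not> b)" using falsifiesD[OF m(2), of x "\<not> b"] by auto
    moreover have "m \<noteq> k" using falsifiesD[OF m(2), of y s] y f(2) by auto
    then have "c m x \<noteq> Some b" using only[OF m(1)] only[OF kl(1,3)] by metis
    ultimately have none: "c m x = None" by (cases "c m x") auto
    then have "falsifies f (c m)" using m(2) unfolding falsifies_def
      by (metis fun_upd_other option.distinct(1))
    then have "m = l" using f(1) m(1) by (simp add: only_falsifies_def)
    then show False using none kl(4) by simp
  qed
  have "c i y = c j y" if "y \<noteq> x" for y
    using sub[OF that, of i _ j True] sub[OF that, of j _ i False] ij
    by (cases "c i y"; cases "c j y") auto
  moreover have "k = i \<or> k = j" if "k \<in> I" "c k x \<noteq> None" for k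
    using only[OF that(1)] that(2) by (metis option.exhaust)
  moreover have "i \<noteq> j" using ij by auto
  ultimately show ?thesis using that x(1) ij deg2 by blast
qed

lemma mu_dom_nonempty:
  assumes "mu I V c" "i \<in> I" "card I \<ge> 2"
  shows "dom (c i) \<noteq> {}"
proof
  assume e: "dom (c i) = {}"
  have "j = i" if "j \<in> I" for j
    using mu_subsume[OF assms(1,2) that] e by (auto simp: map_le_def)
  then have "I \<subseteq> {i}" by blast
  then show False using assms(3) card_mono[of "{i}" I] by simp
qed

lemma card_minus: "finite V \<Longrightarrow> x \<in> V \<Longrightarrow> card V = card (V - {x}) + 1"
  using card.remove[of V x] by simp

text \<open>Stripping \<open>x\<close> and dropping \<open>j\<close> replaces the two clauses by
  their resolvent: two sibling leaves of a binary tree collapse into their parent. This is the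
  induction step for both structural lemmas below.\<close>

lemma contraction_step:
  fixes I :: "'i set" and V :: "'v set"
  assumes mu: "mu I V c" "saturated I V c" and used: "used I V c"
    and ne: "V \<noteq> {}" and card: "card I \<le> card V + 1"
  obtains x i j where "x \<in> V" "i \<in> I" "j \<in> I" "i \<noteq> j" "c i x = Some True" "c j x = Some False"
    "\<forall>k\<in>I. c k x \<noteq> None \<longrightarrow> k = i \<or> k = j" "\<forall>y. y \<noteq> x \<longrightarrow> c i y = c j y"
    "deg I c x = 2" "mu (I - {j}) (V - {x}) (strip c x)" "used (I - {j}) (V - {x}) (strip c x)"
    "card V = card (V - {x}) + 1" "card I = card (I - {j}) + 1"
proof -
  have fin: "finite I" "finite V" using muD[OF mu(1)] by auto
  obtain x i j where x: "x \<in> V" and ij: "i \<in> I" "j \<in> I" "i \<noteq> j" "c i x = Some True" "c j x = Some False"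
    and only: "\<forall>k\<in>I. c k x \<noteq> None \<longrightarrow> k = i \<or> k = j"
    and same: "\<forall>y. y \<noteq> x \<longrightarrow> c i y = c j y" and dx: "deg I c x = 2"
    by (rule contraction[OF mu used ne card])
  have "k = j" if "k \<in> I" "c k x = Some False" for k
    using only that ij(4) by auto
  then have rest: "rest I c x False = I - {j}"
    unfolding rest_def using ij by blast
  have muJ: "mu (I - {j}) (V - {x}) (strip c x)"
    using saturated_split[OF mu x, of False] rest by simp
  have usedJ: "used (I - {j}) (V - {x}) (strip c x)"
    unfolding used_def
  proof
    fix y assume y: "y \<in> V - {x}"
    then obtain k where k: "k \<in> I" "c k y \<noteq> None" using used unfolding used_def by blast
    show "\<exists>k\<in>I - {j}. strip c x k y \<noteq> None"
    proof (cases "k = j")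
      case True
      then show ?thesis using k ij y same by (intro bexI[of _ i]) (auto simp: strip_def)
    next
      case False
      then show ?thesis using k y by (intro bexI[of _ k]) (auto simp: strip_def)
    qed
  qed
  show ?thesis
    by (rule that[OF x ij only same dx muJ usedJ card_minus[OF fin(2) x] card_minus[OF fin(1) ij(2)]])
qed

text \<open>A tree of clauses with a single lowest branching is a caterpillar, hence has a unit clause at
  its root.\<close>

lemma ex_unit_clause:
  fixes I :: "'i set" and V :: "'v set"
  assumes "mu I V c" "used I V c" "V \<noteq> {}" "card I \<le> card V + 1" "m \<in> I"
    and "\<forall>x\<in>V. deg I c x \<le> 2 \<longrightarrow> c m x \<noteq> None"
  shows "\<exists>i\<in>I. \<exists>x. dom (c i) = {x}"
  using assms
proof (induction "card V" arbitrary: I V c m rule: less_induct)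
  case less
  note mu = less.prems(1)
  have fin: "finite I" "finite V" using muD[OF mu] by auto
  obtain c' where c': "mu I V c'" "saturated I V c'" and le: "\<forall>i\<in>I. c i \<subseteq>\<^sub>m c' i"
    using exists_saturation[OF mu] .
  have used': "used I V c'" using used_mono[OF less.prems(2) le] .
  obtain x i j where x: "x \<in> V" and ij: "i \<in> I" "j \<in> I" "i \<noteq> j" "c' i x = Some True" "c' j x = Some False"
    and only: "\<forall>k\<in>I. c' k x \<noteq> None \<longrightarrow> k = i \<or> k = j"
    and same: "\<forall>y. y \<noteq> x \<longrightarrow> c' i y = c' j y" and dx: "deg I c' x = 2"
    and muJ: "mu (I - {j}) (V - {x}) (strip c' x)" and usedJ: "used (I - {j}) (V - {x}) (strip c' x)"
    and cW: "card V = card (V - {x}) + 1" and cJ: "card I = card (I - {j}) + 1"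
    by (rule contraction_step[OF c' used' less.prems(3,4)])
  note only = only[rule_format] and same = same[rule_format]
  have two: "card I \<ge> 2" using card_mono[OF fin(1), of "{i, j}"] ij by simp
  have unit: ?case if "k \<in> I" "dom (c' k) \<subseteq> {y}" for k y
  proof -
    have "dom (c k) \<subseteq> dom (c' k)" using le that(1) by (simp add: map_le_implies_dom_le)
    then have "dom (c k) = {y}" using mu_dom_nonempty[OF mu that(1) two] that(2) by blast
    then show ?thesis using that(1) by blast
  qed
  have deg_le: "deg I c y \<le> deg I c' y" for y using deg_mono[OF fin(1) le] .
  have low: "c' m y \<noteq> None" if "y \<in> V" "deg I c' y \<le> 2" for y
  proof -
    have "c m y \<noteq> None" using less.prems(6) that deg_le[of y] by fastforce
    then show ?thesis using map_le_not_None[of "c m" "c' m" y] le less.prems(5) by auto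
  qed
  have mij: "m = i \<or> m = j" using only[OF less.prems(5) low[OF x]] dx by simp
  have low_i: "c' i y \<noteq> None" if "y \<in> V" "y \<noteq> x" "deg I c' y \<le> 2" for y
    using low[OF that(1,3)] mij same[OF that(2)] by metis
  let ?J = "I - {j}" and ?W = "V - {x}" and ?d = "strip c' x"
  show ?case
  proof (cases "?W = {}")
    case True
    then have "dom (c' i) \<subseteq> {x}" using muD(3)[OF c'(1) ij(1)] by blast
    then show ?thesis using unit ij by blast
  next
    case False
    have degJ: "deg I c' y = deg ?J ?d y" if "y \<noteq> x" "c' i y = None" for y
    proof -
      have "{k\<in>I. c' k y \<noteq> None} = {k\<in>?J. c' k y \<noteq> None}" using same that by auto
      then show ?thesis using that by (simp add: deg_def strip_def)
    qed
    \<comment> \<open>The merged clause inherits the role of \<open>m\<close>: a variable outside it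
      keeps its degree under the contraction, so it cannot be low.\<close>
    have lowJ: "\<forall>y\<in>?W. deg ?J ?d y \<le> 2 \<longrightarrow> ?d i y \<noteq> None"
    proof (intro ballI impI)
      fix y assume "y \<in> ?W" "deg ?J ?d y \<le> 2"
      then show "?d i y \<noteq> None"
        using degJ[of y] low_i[of y] by (cases "c' i y = None") (auto simp: strip_def)
    qed
    have "\<exists>k\<in>?J. \<exists>y. dom (?d k) = {y}"
      by (rule less.hyps[OF _ muJ usedJ False _ _ lowJ]) (use cW cJ less.prems(4) ij in auto)
    then obtain k y where k: "k \<in> I" "k \<noteq> j" and dk: "dom (?d k) = {y}" by blast
    show ?thesis
    proof (cases "k = i")
      case False
      then have "dom (c' k) = {y}" using dk only[OF k(1)] k(2) by (auto simp: strip_def)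
      then show ?thesis using unit k by blast
    next
      case True
      \<comment> \<open>The unit clause found is the merged one, so \<open>i\<close> and
        \<open>j\<close> contain nothing but \<open>x\<close> and \<open>y\<close>. Either another
        clause lives on \<open>y\<close> alone, or propagation exposes a variable of low degree that
        avoids \<open>i\<close>.\<close>
      obtain b where b: "?d i = [y \<mapsto> b]"
        using dk unfolding True dom_eq_singleton_conv by blast
      have y: "y \<in> dom (?d i)" by (simp add: b)
      then have yx: "y \<noteq> x" unfolding strip_def by auto
      have iJ: "i \<in> ?J" using ij by blast
      have yW: "y \<in> ?W" using muD(3)[OF muJ iJ] y by blast
      let ?K = "?J - {i}" and ?U = "?W - {y}"
      have muK: "mu ?K ?U (strip ?d y)"
        by (rule mu_unit_propagation(1)[OF muJ iJ b])
      have none: "c' k z = None" if "z \<noteq> x" "z \<noteq> y" "k = i \<or> k = j" for k z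
      proof -
        have "?d i z = None" using b that by simp
        then have "c' i z = None" using that by (simp add: strip_def)
        then show ?thesis using that(3) same[OF that(1)] by metis
      qed
      show ?thesis
      proof (cases "?U = {}")
        case True
        obtain l where l: "l \<in> ?K" using mu_nonempty[OF muK] by blast
        then have "c' l x = None" using only[of l] by blast
        moreover have "dom (c' l) \<subseteq> V" using muD(3)[OF c'(1), of l] l by blast
        ultimately have "dom (c' l) \<subseteq> {y}" using True domIff[of x "c' l"] by fast
        then show ?thesis using unit l by blast
      next
        case False
        have "card ?W = card ?U + 1" "card ?J = card ?K + 1"
          using card_minus[of ?W y] card_minus[of ?J i] fin yW ij by auto
        then have "card ?K \<le> card ?U + 1" using less.prems(4) cW cJ by linarith
        then obtain z where z: "z \<in> ?U" "deg ?K (strip ?d y) z \<le> 2"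
          using boundedD[OF bounded_1 muK] False by blast
        have "{k\<in>I. c' k z \<noteq> None} = {k\<in>?K. c' k z \<noteq> None}" using none z by auto
        then have "deg I c' z \<le> 2" using z by (simp add: deg_def strip_def)
        then show ?thesis using low_i[of z] none[of z i] z by auto
      qed
    qed
  qed
qed

text \<open>Two leaves of a binary tree are separated at one node. The pair \<open>i\<close>,
  \<open>j\<close> agrees outside \<open>x\<close>; any other pair cannot clash in \<open>x\<close>,
  which only these two contain, so its clashes persist when \<open>j\<close> is replaced by the
  merged clause.\<close>

lemma clash_unique:
  fixes I :: "'i set" and V :: "'v set"
  assumes "mu I V c" "used I V c" "card I \<le> card V + 1" "p \<in> I" "q \<in> I"
    and "c p y = Some b" "c q y = Some (\<not> b)" "c p z = Some d" "c q z = Some (\<not> d)"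
  shows "y = z"
  using assms
proof (induction "card V" arbitrary: I V c p q b d rule: less_induct)
  case less
  note mu = less.prems(1)
  have fin: "finite I" "finite V" using muD[OF mu] by auto
  have "y \<in> V" using muD(3)[OF mu less.prems(4)] less.prems(6) by auto
  then have ne: "V \<noteq> {}" by blast
  obtain c' where c': "mu I V c'" "saturated I V c'" and le: "\<forall>i\<in>I. c i \<subseteq>\<^sub>m c' i"
    using exists_saturation[OF mu] .
  have used': "used I V c'" using used_mono[OF less.prems(2) le] .
  have pq: "c' p y = Some b" "c' q y = Some (\<not> b)" "c' p z = Some d" "c' q z = Some (\<not> d)"
    using less.prems(4-9) le map_le_not_None by (metis option.distinct(1))+
  obtain x i j where x: "x \<in> V" and ij: "i \<in> I" "j \<in> I" "i \<noteq> j" "c' i x = Some True" "c' j x = Some False"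
    and only: "\<forall>k\<in>I. c' k x \<noteq> None \<longrightarrow> k = i \<or> k = j"
    and same: "\<forall>y. y \<noteq> x \<longrightarrow> c' i y = c' j y"
    and muJ: "mu (I - {j}) (V - {x}) (strip c' x)" and usedJ: "used (I - {j}) (V - {x}) (strip c' x)"
    and cW: "card V = card (V - {x}) + 1" and cJ: "card I = card (I - {j}) + 1"
    by (rule contraction_step[OF c' used' ne less.prems(3)])
  note only = only[rule_format] and same = same[rule_format]
  let ?J = "I - {j}" and ?W = "V - {x}" and ?d = "strip c' x"
  show ?case
  proof (cases "{p, q} = {i, j}")
    case True
    have "w = x" if "c' p w = Some e" "c' q w = Some (\<not> e)" for w e
    proof (rule ccontr)
      assume "w \<noteq> x"
      then have "c' p w = c' q w" using same[of w] True by (auto simp: doubleton_eq_iff)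
      then show False using that by simp
    qed
    then show ?thesis using pq by metis
  next
    case False
    define r where "r k = (if k = j then i else k)" for k
    have r: "r k \<in> ?J" if "k \<in> I" for k using that ij by (auto simp: r_def)
    have pq': "p \<noteq> q" using pq by auto
    have "w \<noteq> x" if "c' p w = Some e" "c' q w = Some (\<not> e)" for w e
      using only[OF less.prems(4)] only[OF less.prems(5)] that pq' False by (auto simp: insert_commute)
    then have yz: "y \<noteq> x" "z \<noteq> x" using pq by blast+
    have eq: "?d (r k) w = c' k w" if "w \<noteq> x" for k w
      using same[OF that] that by (simp add: strip_def r_def)
    show ?thesis
      by (rule less.hyps[OF _ muJ usedJ _ r[OF less.prems(4)] r[OF less.prems(5)]])
         (use cW cJ less.prems(3) pq yz eq in auto)
  qed
qed

section \<open>Deficiency 6\<close>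

lemma deg_le_card: "finite I \<Longrightarrow> deg I c x \<le> card I"
  unfolding deg_def by (intro card_mono) auto

lemma card_vars_ge_3:
  assumes "mu I V c" "V \<noteq> {}" "card I \<le> card V + 6" "\<forall>z\<in>V. 9 \<le> deg I c z"
  shows "card V \<ge> 3"
proof -
  obtain z where "z \<in> V" using assms(2) by blast
  then have "9 \<le> card I" using assms(4) deg_le_card[OF muD(1)[OF assms(1)], of c z] by fastforce
  then show ?thesis using assms(3) by linarith
qed

text \<open>Containing \<open>y\<close> with the same sign would make \<open>j\<close> subsumed. If
  \<open>y\<close> were missing, saturation would give a private assignment of \<open>j\<close> with
  value \<beta> at \<open>y\<close>, which falsifies the binary clause as well.\<close>

lemma saturated_binary:
  assumes mu: "mu I V c" "saturated I V c" and i: "i \<in> I" "c i = [x \<mapsto> \<alpha>, y \<mapsto> \<beta>]" "x \<noteq> y"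
    and j: "j \<in> I" "j \<noteq> i" "c j x = Some \<alpha>"
  shows "c j y = Some (\<not> \<beta>)"
proof (cases "c j y")
  case None
  have "y \<in> V" using muD(3)[OF mu(1) i(1)] i(2) by auto
  then obtain f where f: "only_falsifies I c j f" "f y = \<beta>"
    using mu(2) j(1) None unfolding saturated_def by blast
  then have "f x = \<alpha>" using j(3) falsifiesD unfolding only_falsifies_def by fastforce
  then have "falsifies f (c i)" using f(2) i by (auto simp: falsifies_def split: if_splits)
  then show ?thesis using f(1) i(1) j(2) unfolding only_falsifies_def by blast
next
  case (Some d)
  have "\<not> c i \<subseteq>\<^sub>m c j" using mu_subsume[OF mu(1) i(1) j(1)] j(2) by blast
  then have "d \<noteq> \<beta>" using Some j(3) i(3) by (auto simp: i(2) map_le_def)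
  then have "d = (\<not> \<beta>)" by auto
  then show ?thesis using Some by simp
qed

text \<open>Otherwise satisfy the literal of \<open>x\<close> opposite to that in \<open>i\<close>,
  with its \<open>q \<ge> 6\<close> occurrences. The binary clause becomes a unit clause on
  \<open>y\<close>; propagating it leaves deficiency at most 1 if \<open>q = 6\<close> and 0 beyond,
  so some variable has degree at most 2 or 0. Adding \<open>q\<close> back gives at most 8.\<close>

lemma binary_occ_le:
  fixes I :: "'i set" and V :: "'v set"
  assumes mu: "mu I V c" "saturated I V c" and card: "card I \<le> card V + 6"
    and deg: "\<forall>z\<in>V. 9 \<le> deg I c z"
    and i: "i \<in> I" "c i = [x \<mapsto> \<alpha>, y \<mapsto> \<beta>]" "x \<noteq> y" and x: "deg I c x = 9"
  shows "occ I c x (\<not> \<alpha>) \<le> 5"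
proof (rule ccontr)
  let ?q = "occ I c x (\<not> \<alpha>)" and ?J = "rest I c x (\<not> \<alpha>)"
  assume "\<not> ?q \<le> 5"
  then have q: "?q \<ge> 6" by simp
  have fin: "finite I" "finite V" using muD[OF mu(1)] by auto
  have xy: "x \<in> V" "y \<in> V" using muD(3)[OF mu(1) i(1)] i(2) by auto
  have "occ I c x \<alpha> \<ge> 1" using mu_occ_pos[OF mu(1)] x by simp
  then have q8: "?q \<le> 8" using deg_eq_occ[OF fin(1), of c x \<alpha>] x by simp
  have muJ: "mu ?J (V - {x}) (strip c x)" using saturated_split[OF mu xy(1)] .
  have iJ: "i \<in> ?J" using i by (simp add: rest_def)
  have "strip c x i = [y \<mapsto> \<beta>]" using i(3) by (auto simp: strip_def i(2))
  then have muK: "mu (?J - {i}) (V - {x} - {y}) (strip (strip c x) y)"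
    using mu_unit_propagation(1)[OF muJ iJ] by blast
  have "card V \<ge> 3" using card_vars_ge_3[OF mu(1) _ card deg] xy by blast
  moreover have V: "card V = card (V - {x} - {y}) + 2"
    using card_minus[OF fin(2) xy(1)] card_minus[of "V - {x}" y] fin xy i(3) by simp
  ultimately have ne: "V - {x} - {y} \<noteq> {}" by fastforce
  have J: "card ?J + ?q = card I" using card_rest[OF fin(1)] .
  have K: "card ?J = card (?J - {i}) + 1" using card_minus[OF finite_rest[OF fin(1)] iJ] .
  obtain z where z: "z \<in> V - {x} - {y}"
    and dz: "deg (?J - {i}) (strip (strip c x) y) z + ?q \<le> 8"
  proof (cases "?q = 6")
    case True
    then have "card (?J - {i}) \<le> card (V - {x} - {y}) + 1" using J K V card by linarith
    then show ?thesis using boundedD[OF bounded_1 muK] ne that True by fastforce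
  next
    case False
    then have "card (?J - {i}) \<le> card (V - {x} - {y}) + 0" using J K V card q by linarith
    then show ?thesis using boundedD[OF tarsi muK] ne that q8 by fastforce
  qed
  have "c i z = None" using z by (auto simp: i(2))
  then have "{k\<in>?J. c k z \<noteq> None} = {k\<in>?J - {i}. c k z \<noteq> None}" by auto
  then have "deg ?J c z = deg (?J - {i}) (strip (strip c x) y) z"
    using z by (simp add: deg_def strip_def)
  then have "deg I c z \<le> 8" using dz deg_rest_le[OF fin(1), of c z x "\<not> \<alpha>"] by linarith
  then show False using deg z by fastforce
qed

text \<open>Satisfy the literal of \<open>x\<close> in \<open>i\<close>. One of the \<open>p\<close>
  lost clauses is \<open>i\<close> itself, so every variable other than \<open>x\<close> and
  \<open>y\<close> keeps degree at least \<open>10 - p\<close>, and only \<open>y\<close> can meet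
  the bound for the remaining deficiency. Splitting once more, on \<open>y\<close>, exposes a
  further low variable.\<close>

lemma binary_clause_degree:
  fixes I :: "'i set" and V :: "'v set"
  assumes mu: "mu I V c" "saturated I V c" and card: "card I \<le> card V + 6"
    and deg: "\<forall>z\<in>V. 9 \<le> deg I c z"
    and i: "i \<in> I" "c i = [x \<mapsto> \<alpha>, y \<mapsto> \<beta>]" "x \<noteq> y"
  shows "deg I c x \<noteq> 9"
proof
  assume x9: "deg I c x = 9"
  let ?p = "occ I c x \<alpha>" and ?J = "rest I c x \<alpha>" and ?W = "V - {x}" and ?d = "strip c x"
  have fin: "finite I" "finite V" using muD[OF mu(1)] by auto
  have xy: "x \<in> V" "y \<in> V" using muD(3)[OF mu(1) i(1)] i(2) by auto
  have V3: "card V \<ge> 3" using card_vars_ge_3[OF mu(1) _ card deg] xy by blast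
  have sum: "?p + occ I c x (\<not> \<alpha>) = 9" using deg_eq_occ[OF fin(1), of c x \<alpha>] x9 by simp
  have "occ I c x (\<not> \<alpha>) \<ge> 1" using mu_occ_pos[OF mu(1)] x9 by simp
  then have p: "4 \<le> ?p" "?p \<le> 8"
    using sum binary_occ_le[OF mu card deg i x9] by linarith+
  have muJ: "mu ?J ?W ?d" using saturated_split[OF mu xy(1)] .
  have finJ: "finite ?J" using finite_rest[OF fin(1)] .
  have V: "card V = card ?W + 1" using card_minus[OF fin(2) xy(1)] .
  have J: "card ?J + ?p = card I" using card_rest[OF fin(1)] .
  have cardJ: "card ?J \<le> card ?W + (7 - ?p)" using J V card p by linarith
  have deg_other: "deg ?J c z + ?p \<ge> 10" if "z \<in> V" "z \<noteq> x" "z \<noteq> y" for z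
  proof -
    have "c i z = None" using that by (auto simp: i(2))
    then have "{k\<in>I. c k x = Some \<alpha> \<and> c k z \<noteq> None} \<subseteq> {k\<in>I. c k x = Some \<alpha>} - {i}" by auto
    then have "card {k\<in>I. c k x = Some \<alpha> \<and> c k z \<noteq> None} \<le> card ({k\<in>I. c k x = Some \<alpha>} - {i})"
      using fin by (intro card_mono) auto
    also have "\<dots> + 1 = ?p"
      using card_minus[of "{k\<in>I. c k x = Some \<alpha>}" i] fin i by (auto simp: occ_def)
    finally show ?thesis using deg_rest[OF fin(1), of c z x \<alpha>] deg that(1) by fastforce
  qed
  have deg_y: "deg ?J c y + ?p \<ge> 9"
    using deg_rest_le[OF fin(1), of c y x \<alpha>] deg xy(2) by fastforce
  have bound: "bounded TYPE('i \<times> 'v) (7 - ?p) (vdm_bound (7 - ?p))"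
    using p by (intro bounded_le_5) linarith
  have WJ: "?W \<noteq> {}" using V V3 by fastforce
  have only_y: "z = y \<and> ?p \<le> 5" if "z \<in> ?W" "deg ?J c z \<le> vdm_bound (7 - ?p)" for z
  proof -
    consider "?p = 4" | "?p = 5" | "?p = 6" | "?p = 7" | "?p = 8" using p by linarith
    \<comment> \<open>For \<open>?p\<close> from 4 to 8 the sum is 9, 9, 8, 7, 8; at 8 the
      subtraction is truncated to 0.\<close>
    then have *: "vdm_bound (7 - ?p) + ?p \<le> 9 \<and> (?p \<le> 5 \<or> vdm_bound (7 - ?p) + ?p \<le> 8)"
      by cases simp_all
    have "z = y" using deg_other[of z] that * by force
    then show ?thesis using * deg_y that(2) by auto
  qed
  obtain z where "z \<in> ?W" "deg ?J ?d z \<le> vdm_bound (7 - ?p)"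
    using boundedD[OF bound muJ _ cardJ] WJ by blast
  then have "deg ?J c y \<le> vdm_bound (7 - ?p)" and p5: "?p = 4 \<or> ?p = 5"
    using only_y[of z] p by (auto simp: deg_strip)
  then have "deg I c y \<le> 9" using deg_rest_le[OF fin(1), of c y x \<alpha>] by auto
  then have y9: "deg I c y = 9" using deg xy(2) by fastforce
  have i': "c i = [y \<mapsto> \<beta>, x \<mapsto> \<alpha>]" using i by (auto simp: fun_upd_twist)
  have "occ I c y \<beta> \<ge> 4"
    using binary_occ_le[OF mu card deg i(1) i' i(3)[symmetric] y9] deg_eq_occ[OF fin(1), of c y \<beta>] y9
    by linarith
  \<comment> \<open>By \<open>saturated_binary\<close> with exchanged roles, the other clauses with
    this literal of \<open>y\<close> contain \<open>x\<close> with the opposite sign, so they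
    survive in \<open>?J\<close>.\<close>
  moreover have "{k\<in>I. c k y = Some \<beta>} - {i} \<subseteq> {k\<in>?J. c k y = Some \<beta>}"
    using saturated_binary[OF mu i(1) i' i(3)[symmetric]] by (auto simp: rest_def)
  then have "card ({k\<in>I. c k y = Some \<beta>} - {i}) \<le> occ ?J c y \<beta>"
    unfolding occ_def using finJ by (intro card_mono) auto
  moreover have "occ I c y \<beta> = card ({k\<in>I. c k y = Some \<beta>} - {i}) + 1"
    using card_minus[of "{k\<in>I. c k y = Some \<beta>}" i] fin i by (auto simp: occ_def)
  ultimately have occJ: "occ ?J c y \<beta> \<ge> 3" by linarith
  obtain h where h: "mu ?J ?W h" "saturated ?J ?W h" and le: "\<forall>k\<in>?J. ?d k \<subseteq>\<^sub>m h k"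
    using exists_saturation[OF muJ] .
  have degh: "deg ?J c z \<le> deg ?J h z" if "z \<noteq> x" for z
    using deg_mono[OF finJ le, of z] that by (simp add: deg_strip)
  have "occ ?J ?d y \<beta> = occ ?J c y \<beta>" using i(3) by (simp add: occ_def strip_def)
  then have r3: "occ ?J h y \<beta> \<ge> 3" using occ_mono[OF finJ le, of y \<beta>] occJ by linarith
  obtain z where z: "z \<in> ?W" "deg ?J h z \<le> vdm_bound (7 - ?p)"
    using boundedD[OF bound h(1) _ cardJ] WJ by blast
  then have "z = y" using only_y[of z] degh[of z] by fastforce
  then have hy: "deg ?J h y \<le> vdm_bound (7 - ?p)" using z by simp
  have yW: "y \<in> ?W" using xy i(3) by blast
  have "deg ?J h y \<ge> 1" using r3 deg_eq_occ[OF finJ, of h y \<beta>] by linarith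
  then have r: "occ ?J h y \<beta> + 1 \<le> vdm_bound (7 - ?p)"
    using hy deg_eq_occ[OF finJ, of h y \<beta>] mu_occ_pos[OF h(1), of y "\<not> \<beta>"] by linarith
  have no_low: False if "z \<in> ?W" "z \<noteq> y" "deg (rest ?J h y \<beta>) h z + occ ?J h y \<beta> + ?p \<le> 9" for z
    using deg_other[of z] degh[of z] deg_rest_le[OF finJ, of h z y \<beta>] that by fastforce
  \<comment> \<open>The splitting on \<open>y\<close> leaves deficiency 1 or 0. Back in
    \<open>I\<close> the degree is at most \<open>2 + 3 + 4\<close>, \<open>0 + 4 + 4\<close> or
    \<open>0 + 3 + 5\<close>, whereas \<open>deg_other\<close> demands 10 before the last summand
    that \<open>i\<close> spoils.\<close>
  show False
  proof (cases "?p = 4 \<and> occ ?J h y \<beta> = 3")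
    case True
    have "?W \<noteq> {y}" using V V3 by fastforce
    moreover have "card ?J + 1 \<le> card ?W + 1 + occ ?J h y \<beta>" using cardJ True by linarith
    ultimately obtain z where "z \<in> ?W" "z \<noteq> y" "deg (rest ?J h y \<beta>) h z \<le> 2"
      using split_low[OF bounded_1 h yW] by blast
    then show False using no_low[of z] True by simp
  next
    case False
    then have *: "?p = 4 \<and> occ ?J h y \<beta> = 4 \<or> ?p = 5 \<and> occ ?J h y \<beta> = 3" using r r3 p5 by auto
    then have "card ?J + 1 \<le> card ?W + 0 + occ ?J h y \<beta>" using cardJ by linarith
    then obtain z where "z \<in> ?W" "z \<noteq> y" "deg (rest ?J h y \<beta>) h z \<le> 0"
      using split_low[OF tarsi h yW] by blast
    then show False using no_low[of z] * by auto
  qed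
qed

section \<open>Extremal families of deficiency 2\<close>

lemma deficiency_2_occ:
  fixes J :: "'i set" and W :: "'v set"
  assumes mu: "mu J W g" "saturated J W g" and card: "card J \<le> card W + 2"
    and deg: "\<forall>z\<in>W. 4 \<le> deg J g z" and z: "z \<in> W" "deg J g z \<le> 4"
  shows "occ J g z b = 2"
proof -
  have fin: "finite J" using muD[OF mu(1)] by auto
  have le: "occ J g z s \<le> 2" for s
  proof (rule ccontr)
    assume o: "\<not> occ J g z s \<le> 2"
    have "occ J g z (\<not> s) \<ge> 1" using mu_occ_pos[OF mu(1)] deg z(1) by fastforce
    then have o3: "occ J g z s \<le> 3" using deg_eq_occ[OF fin, of g z s] z(2) by linarith
    have "card J + 1 \<le> card W + 0 + occ J g z s" using card o by linarith
    then obtain y where y: "y \<in> W" "deg (rest J g z s) g y \<le> 0"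
      using split_low[OF tarsi mu z(1)] by blast
    then have "deg J g y \<le> 3" using deg_rest_le[OF fin, of g y z s] o3 by linarith
    then show False using deg y(1) by fastforce
  qed
  have "occ J g z b + occ J g z (\<not> b) = 4"
    using deg z deg_eq_occ[OF fin, of g z b] by fastforce
  then show ?thesis using le[of b] le[of "\<not> b"] by linarith
qed

text \<open>Both splittings on \<open>w\<close> have deficiency 1 and are played against each other.
  A variable of degree 2 left after removing the two \<open>b\<close>-clauses occurs in both of
  them, with opposite signs because each sign occurs exactly twice in \<open>J\<close>. These two
  clauses survive in the other splitting, where \<open>clash_unique\<close> applies; so there is
  only one such variable, and \<open>ex_unit_clause\<close> yields a unit clause.\<close>

lemma deficiency_2_structure:
  fixes J :: "'i set" and W :: "'v set"
  assumes mu: "mu J W g" "saturated J W g" and card: "card J \<le> card W + 2"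
    and deg: "\<forall>z\<in>W. 4 \<le> deg J g z" and w: "w \<in> W" "deg J g w \<le> 4" and W: "W \<noteq> {w}"
  shows "\<exists>i\<in>J. \<exists>z. g i w \<noteq> Some b \<and> dom (g i) - {w} = {z}"
    and "\<exists>t\<in>W - {w}. deg J g t \<le> 4 \<and> (\<forall>i\<in>J. g i w = Some b \<longrightarrow> g i t \<noteq> None)"
proof -
  have fin: "finite J" "finite W" using muD[OF mu(1)] by auto
  let ?N = "\<lambda>b. rest J g w b" and ?U = "W - {w}" and ?d = "strip g w"
  have o: "occ J g w s = 2" for s using deficiency_2_occ[OF mu card deg w] .
  have muN: "mu (?N s) ?U ?d" for s using saturated_split[OF mu w(1)] .
  have finN: "finite (?N s)" for s using finite_rest[OF fin(1)] .
  have cN: "card (?N s) \<le> card ?U + 1" for s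
    using card_rest[OF fin(1), of g w s] o[of s] card card_minus[OF fin(2) w(1)] by linarith
  have cN_ne: "?U \<noteq> {}" using W w by blast
  have degN: "deg (?N s) ?d z \<ge> 2" if "z \<in> ?U" for z s
  proof -
    have "4 \<le> deg J g z" "z \<noteq> w" using deg that by blast+
    then show ?thesis using deg_rest_le[OF fin(1), of g z w s] o[of s] by (simp add: deg_strip)
  qed
  have usedN: "used (?N s) ?U ?d" for s
    unfolding used_iff_deg[OF finN] using degN one_le_numeral order_trans by blast
  have low: "deg J g z \<le> 4 \<and> (\<forall>i\<in>J. g i w = Some s \<longrightarrow> g i z \<noteq> None)"
    if z: "z \<in> ?U" "deg (?N s) ?d z \<le> 2" for z s
  proof -
    have sub: "{k\<in>J. g k w = Some s \<and> g k z \<noteq> None} \<subseteq> {k\<in>J. g k w = Some s}" by blast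
    have c2: "card {k\<in>J. g k w = Some s} = 2" using o[of s] by (simp add: occ_def)
    have d: "deg J g z = deg (?N s) ?d z + card {k\<in>J. g k w = Some s \<and> g k z \<noteq> None}"
      using deg_rest[OF fin(1), of g z w s] z(1) by (simp add: deg_strip)
    moreover have le: "card {k\<in>J. g k w = Some s \<and> g k z \<noteq> None} \<le> 2"
      using card_mono[OF _ sub] c2 fin by simp
    moreover have "4 \<le> deg J g z" using deg z(1) by blast
    ultimately have "card {k\<in>J. g k w = Some s \<and> g k z \<noteq> None} = 2" using z(2) by linarith
    then have "{k\<in>J. g k w = Some s \<and> g k z \<noteq> None} = {k\<in>J. g k w = Some s}"
      using card_subset_eq[OF _ sub] c2 fin by simp
    then show ?thesis using d le z(2) by fastforce
  qed
  have ex_low: "\<exists>z\<in>?U. deg (?N s) ?d z \<le> 2" for s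
    using boundedD[OF bounded_1 muN] cN_ne cN by blast
  show "\<exists>t\<in>W - {w}. deg J g t \<le> 4 \<and> (\<forall>i\<in>J. g i w = Some b \<longrightarrow> g i t \<noteq> None)"
    using ex_low[of b] low by blast
  obtain p q where pq: "{k\<in>J. g k w = Some b} = {p, q}" "p \<noteq> q"
    using o[of b] unfolding occ_def card_2_iff by blast
  have pJ: "p \<in> J" "q \<in> J" "g p w = Some b" "g q w = Some b" using pq by blast+
  have pN: "p \<in> ?N (\<not> b)" "q \<in> ?N (\<not> b)" using pJ by (auto simp: rest_def)
  have clash: "\<exists>d. ?d p z = Some d \<and> ?d q z = Some (\<not> d)"
    if z: "z \<in> ?U" "deg (?N b) ?d z \<le> 2" for z
  proof -
    have "g p z \<noteq> None" "g q z \<noteq> None" using low[OF z] pJ by blast+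
    then obtain d e where de: "g p z = Some d" "g q z = Some e" by blast
    have "e \<noteq> d"
    proof
      assume "e = d"
      have "occ (?N b) ?d z d \<ge> 1" using mu_occ_pos[OF muN] degN[OF z(1), of b] by fastforce
      then have "{k\<in>?N b. ?d k z = Some d} \<noteq> {}" unfolding occ_def by (metis card.empty not_one_le_zero)
      then obtain r where r: "r \<in> ?N b" "g r z = Some d" using z(1) by (auto simp: strip_def)
      then have "r \<noteq> p" "r \<noteq> q" using pJ by (auto simp: rest_def)
      moreover have "{p, q, r} \<subseteq> {k\<in>J. g k z = Some d}"
        using pJ de \<open>e = d\<close> r by (auto simp: rest_def)
      then have "card {p, q, r} \<le> occ J g z d" unfolding occ_def using fin by (intro card_mono) auto
      ultimately have "3 \<le> occ J g z d" using pq(2) by simp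
      then show False using deficiency_2_occ[OF mu card deg, of z d] z(1) low[OF z] by simp
    qed
    then have "e = (\<not> d)" by auto
    then show ?thesis using de z(1) by (auto simp: strip_def)
  qed
  have unique: "z = z'" if "z \<in> ?U" "deg (?N b) ?d z \<le> 2" "z' \<in> ?U" "deg (?N b) ?d z' \<le> 2" for z z'
    using clash[OF that(1,2)] clash[OF that(3,4)] clash_unique[OF muN usedN cN pN] by blast
  obtain z where z: "z \<in> ?U" "deg (?N b) ?d z \<le> 2" using ex_low by blast
  obtain m where m: "m \<in> ?N b" "?d m z \<noteq> None"
    using usedN[of b] z(1) unfolding used_def by blast
  have "\<forall>x\<in>?U. deg (?N b) ?d x \<le> 2 \<longrightarrow> ?d m x \<noteq> None" using unique[OF z] m(2) by blast
  from ex_unit_clause[OF muN usedN cN_ne cN m(1) this] obtain i y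
    where i: "i \<in> ?N b" "dom (?d i) = {y}" by blast
  have "dom (?d i) = dom (g i) - {w}" by (auto simp: strip_def)
  then show "\<exists>i\<in>J. \<exists>z. g i w \<noteq> Some b \<and> dom (g i) - {w} = {z}"
    using i by (auto simp: rest_def)
qed

section \<open>Excluding minimal degree 9 in deficiency 6\<close>

lemma subset_doubletonD: "D \<subseteq> {a, b} \<Longrightarrow> D = {} \<or> D = {a} \<or> D = {b} \<or> D = {a, b}"
  by blast

text \<open>At least 7, exactly 6 or exactly 5 occurrences of a literal leave at most 0, 2 or 4 for
  its complement; only 5 + 4 reaches 9.\<close>

lemma min_degree_9_split:
  fixes I :: "'i set" and V :: "'v set"
  assumes mu: "mu I V c" "saturated I V c" and ne: "V \<noteq> {}" and card: "card I \<le> card V + 6"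
    and deg: "\<forall>z\<in>V. 9 \<le> deg I c z"
  shows "\<exists>v\<in>V. \<exists>s. occ I c v s = 5 \<and> occ I c v (\<not> s) = 4"
proof -
  have fin: "finite I" "finite V" using muD[OF mu(1)] by auto
  obtain v where v: "v \<in> V" "\<forall>y\<in>V. deg I c v \<le> deg I c y" using ex_min_deg[OF fin(2) ne] by blast
  have "V \<noteq> {v}" using card_vars_ge_3[OF mu(1) ne card deg] by auto
  then have le: "7 \<le> j + occ I c v s \<Longrightarrow> j \<le> 5 \<Longrightarrow> occ I c v (\<not> s) \<le> vdm_bound j" for j s
    using min_deg_occ_le[OF bounded_le_5 mu v _ card, of j s] by simp
  have 9: "occ I c v True + occ I c v False \<ge> 9"
    using deg v(1) deg_eq_occ[OF fin(1), of c v True] by fastforce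
  have pos: "occ I c v s \<ge> 1" for s
    using mu_occ_pos[OF mu(1)] deg v(1) by fastforce
  have *: "occ I c v s = 5 \<and> occ I c v (\<not> s) = 4" if ge: "occ I c v (\<not> s) \<le> occ I c v s" for s
  proof -
    have sum: "occ I c v s + occ I c v (\<not> s) \<ge> 9" using 9 by (cases s) auto
    then consider "occ I c v s = 5" | "occ I c v s = 6" | "occ I c v s \<ge> 7" using ge by linarith
    then show ?thesis
      using le[of 2 s] le[of 1 s] le[of 0 s] pos[of "\<not> s"] sum ge by cases auto
  qed
  have "occ I c v (\<not> True) \<le> occ I c v True \<or> occ I c v (\<not> False) \<le> occ I c v False" by auto
  then show ?thesis using v(1) * by blast
qed

text \<open>Let \<open>v\<close> occur five times as one literal and four times as the other. Both splittings on
  \<open>v\<close> are so tight that they force \<open>v\<close> and two further variables \<open>w\<close>, \<open>y\<close> into nine common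
  clauses, two of which contain nothing else; then some further variable has too low a degree.\<close>

lemma no_min_degree_9_core:
  fixes I :: "'i set" and V :: "'v set"
  assumes mu: "mu I V c" "saturated I V c" and ne: "V \<noteq> {}" and card: "card I \<le> card V + 6"
    and deg: "\<forall>z\<in>V. 9 \<le> deg I c z"
    and unit: "\<forall>i\<in>I. \<forall>x. dom (c i) \<noteq> {x}"
  shows False
proof -
  have fin: "finite I" "finite V" using muD[OF mu(1)] by auto
  have V3: "card V \<ge> 3" using card_vars_ge_3[OF mu(1) ne card deg] .
  obtain v s where v: "v \<in> V" "occ I c v s = 5" "occ I c v (\<not> s) = 4"
    using min_degree_9_split[OF mu ne card deg] by blast
  have v9: "deg I c v = 9" using v deg_eq_occ[OF fin(1), of c v s] by simp
  let ?K = "{i\<in>I. c i v = Some s}" and ?L = "{i\<in>I. c i v = Some (\<not> s)}"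
  have cK: "card ?K = 5" and cL: "card ?L = 4" using v by (auto simp: occ_def)
  let ?W = "V - {v}"
  have VW: "card V = card ?W + 1" using card_minus[OF fin(2) v(1)] .
  have binary: "dom (c i) \<noteq> {x, y}" if "i \<in> I" "x \<noteq> y" "deg I c x = 9" for i x y
  proof
    assume d: "dom (c i) = {x, y}"
    then obtain a b where ab: "c i x = Some a" "c i y = Some b" by blast
    have "c i = [x \<mapsto> a, y \<mapsto> b]"
    proof
      fix z
      show "c i z = [x \<mapsto> a, y \<mapsto> b] z"
        using ab d that(2) domIff[of z "c i"] by auto
    qed
    then show False using binary_clause_degree[OF mu card deg that(1) _ that(2)] that(3) by blast
  qed

  let ?J = "rest I c v s"
  have finJ: "finite ?J" using finite_rest[OF fin(1)] .
  have muJ: "mu ?J ?W (strip c v)" using saturated_split[OF mu v(1)] .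
  obtain g where g: "mu ?J ?W g" "saturated ?J ?W g" and gle: "\<forall>k\<in>?J. strip c v k \<subseteq>\<^sub>m g k"
    using exists_saturation[OF muJ] .
  have cJ: "card ?J \<le> card ?W + 2" using card_rest[OF fin(1), of c v s] v(2) card VW by linarith
  have dJ: "deg I c z = deg ?J c z + card {k\<in>?K. c k z \<noteq> None}" for z
    using deg_rest[OF fin(1), of c z v s] by (simp add: conj_assoc)
  have kle: "card {k\<in>?K. c k z \<noteq> None} \<le> 5" for z
    using card_mono[of ?K "{k\<in>?K. c k z \<noteq> None}"] cK fin by auto
  have degJ: "deg ?J c z \<le> deg ?J g z" "4 \<le> deg ?J c z" if "z \<in> ?W" for z
  proof -
    have "9 \<le> deg I c z" "z \<noteq> v" using deg that by blast+
    then show "deg ?J c z \<le> deg ?J g z" "4 \<le> deg ?J c z"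
      using deg_mono[OF finJ gle, of z] dJ[of z] kle[of z] by (simp_all add: deg_strip)
  qed
  have deg_g: "\<forall>z\<in>?W. 4 \<le> deg ?J g z" using degJ by fastforce
  \<comment> \<open>Everything is tight: \<open>z\<close> occurs in all five lost clauses, and
    saturating \<open>?J\<close> has added nothing at \<open>z\<close>.\<close>
  have low_J: "deg I c z = 9 \<and> (\<forall>k\<in>?K. c k z \<noteq> None) \<and> (\<forall>k\<in>?J. g k z = c k z)"
    if z: "z \<in> ?W" "deg ?J g z \<le> 4" for z
  proof -
    have d4: "deg ?J c z = 4" "deg ?J g z = 4" using degJ[OF z(1)] z(2) by linarith+
    moreover have "9 \<le> deg I c z" using deg z(1) by blast
    ultimately have c5: "card {k\<in>?K. c k z \<noteq> None} = 5" "deg I c z = 9"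
      using dJ[of z] kle[of z] by linarith+
    have "{k\<in>?K. c k z \<noteq> None} = ?K"
      using c5 cK fin by (intro card_subset_eq) auto
    moreover have sub: "g k z = c k z" if "k \<in> ?J" "c k z \<noteq> None" for k
      using map_le_not_None[of "strip c v k" "g k" z] gle that z(1) by (auto simp: strip_def)
    have "{k\<in>?J. c k z \<noteq> None} = {k\<in>?J. g k z \<noteq> None}"
      using d4 finJ sub unfolding deg_def by (intro card_subset_eq) auto
    then have "c k z \<noteq> None \<longleftrightarrow> g k z \<noteq> None" if "k \<in> ?J" for k using that by blast
    then have "g k z = c k z" if "k \<in> ?J" for k using sub[OF that] that by metis
    ultimately show ?thesis using c5(2) by blast
  qed
  have W0: "?W \<noteq> {}" using VW V3 by fastforce
  obtain w where w: "w \<in> ?W" "deg ?J g w \<le> 4"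
    using boundedD[OF bounded_le_5[of 2] g(1) _] W0 cJ by auto
  have W1: "?W \<noteq> {w}" using VW V3 by fastforce
  \<comment> \<open>A clause of \<open>g\<close> with one variable besides \<open>w\<close> comes
    from a clause over \<open>v\<close>, \<open>w\<close>, \<open>y\<close>. It cannot be shorter:
    unit clauses are excluded, and a binary one would contain \<open>v\<close> or \<open>w\<close>,
    both of degree 9.\<close>
  have ternary: "\<exists>i\<in>?J. \<exists>y\<in>?W - {w}. g i w = Some b \<and> c i v = Some (\<not> s) \<and> c i w = Some b \<and>
      dom (c i) = {v, w, y} \<and> dom (g i) = {w, y} \<and> deg ?J g y \<le> 4" for b
  proof -
    from deficiency_2_structure(1)[OF g cJ deg_g w W1, of "\<not> b"]
    obtain i y where i: "i \<in> ?J" "g i w \<noteq> Some (\<not> b)" "dom (g i) - {w} = {y}" by blast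
    have iI: "i \<in> I" using i(1) by (simp add: rest_def)
    have y: "y \<in> ?W - {w}" 
    proof -
      have "y \<in> dom (g i) - {w}" by (simp add: i(3))
      then show ?thesis using muD(3)[OF g(1) i(1)] by fast
    qed
    have "dom (strip c v i) \<subseteq> dom (g i)" using gle i(1) by (simp add: map_le_implies_dom_le)
    moreover have "dom (strip c v i) = dom (c i) - {v}" by (auto simp: strip_def)
    ultimately have "dom (c i) - {v} - {w} \<subseteq> {y}" using i(3) by (metis Diff_mono order_refl)
    then have sub: "dom (c i) \<subseteq> {v, w, y}" by fast
    have "card I \<ge> 2" using v9 deg_le_card[OF fin(1), of c v] by simp
    then have "dom (c i) \<noteq> {}" using mu_dom_nonempty[OF mu(1) iI] by blast
    moreover have "dom (c i) \<noteq> {x}" for x using unit iI by blast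
    ultimately have full: "dom (c i) = {a, b}" if "dom (c i) \<subseteq> {a, b}" for a b
      using that subset_doubletonD by metis
    have "v \<noteq> w" "v \<noteq> y" "w \<noteq> y" using w(1) y by blast+
    then have "\<not> dom (c i) \<subseteq> {v, w}" "\<not> dom (c i) \<subseteq> {v, y}" "\<not> dom (c i) \<subseteq> {w, y}"
      using full binary[OF iI] v9 low_J[OF w] by metis+
    then have "v \<in> dom (c i)" "w \<in> dom (c i)" "y \<in> dom (c i)" using sub by fast+
    then have dom: "dom (c i) = {v, w, y}" using sub by fast
    then have "c i v \<noteq> None" "c i w \<noteq> None" using domIff[of _ "c i"] by blast+
    moreover have gw: "g i w = c i w" using low_J[OF w] i(1) by blast
    ultimately have ci: "c i v = Some (\<not> s)" "c i w = Some b"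
      using i(1,2) by (auto simp: rest_def)
    have "w \<in> dom (g i)" using gw ci(2) by auto
    then have dg: "dom (g i) = {w, y}" using i(3) by fast
    \<comment> \<open>Shows that \<open>y\<close> has low degree: some low variable occurs in all
      clauses with this literal of \<open>w\<close>, hence in \<open>i\<close>, which offers only
      \<open>y\<close>.\<close>
    from deficiency_2_structure(2)[OF g cJ deg_g w W1, of b]
    obtain t where t: "t \<in> ?W - {w}" "deg ?J g t \<le> 4" "\<forall>i\<in>?J. g i w = Some b \<longrightarrow> g i t \<noteq> None"
      by blast
    have "g i t \<noteq> None" using t(3) i(1) gw ci(2) by simp
    then have "t \<in> {w, y}" unfolding dg[symmetric] by (simp add: domIff)
    then have "t = y" using t(1) by blast
    then show ?thesis using i(1) y gw ci dom dg t(2) by auto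
  qed
  obtain i1 y where i1: "i1 \<in> ?J" "y \<in> ?W - {w}" "g i1 w = Some True" "c i1 v = Some (\<not> s)"
    "dom (c i1) = {v, w, y}" "dom (g i1) = {w, y}" "deg ?J g y \<le> 4"
    using ternary[of True] by blast
  obtain i0 y0 where i0: "i0 \<in> ?J" "y0 \<in> ?W - {w}" "g i0 w = Some False" "c i0 v = Some (\<not> s)"
    "dom (c i0) = {v, w, y0}" "dom (g i0) = {w, y0}" "deg ?J g y0 \<le> 4"
    using ternary[of False] by blast

  let ?M = "rest I c v (\<not> s)"
  have finM: "finite ?M" using finite_rest[OF fin(1)] .
  have muM: "mu ?M ?W (strip c v)" using saturated_split[OF mu v(1)] .
  obtain h where h: "mu ?M ?W h" "saturated ?M ?W h" and hle: "\<forall>k\<in>?M. strip c v k \<subseteq>\<^sub>m h k"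
    using exists_saturation[OF muM] .
  have cM: "card ?M \<le> card ?W + 3" using card_rest[OF fin(1), of c v "\<not> s"] v(3) card VW by linarith
  have dM: "deg I c z = deg ?M c z + card {k\<in>?L. c k z \<noteq> None}" for z
    using deg_rest[OF fin(1), of c z v "\<not> s"] by (simp add: conj_assoc)
  have lle: "card {k\<in>?L. c k z \<noteq> None} \<le> 4" for z
    using card_mono[of ?L "{k\<in>?L. c k z \<noteq> None}"] cL fin by auto
  have degM: "deg ?M c z \<le> deg ?M h z" "5 \<le> deg ?M c z" if "z \<in> ?W" for z
  proof -
    have "9 \<le> deg I c z" "z \<noteq> v" using deg that by blast+
    then show "deg ?M c z \<le> deg ?M h z" "5 \<le> deg ?M c z"
      using deg_mono[OF finM hle, of z] dM[of z] lle[of z] by (simp_all add: deg_strip)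
  qed
  have low_M: "\<forall>k\<in>?L. c k z \<noteq> None" if z: "z \<in> ?W" "deg ?M h z \<le> 5" for z
  proof -
    have "deg ?M c z = 5" using degM[OF z(1)] z(2) by linarith
    moreover have "9 \<le> deg I c z" using deg z(1) by blast
    ultimately have "card {k\<in>?L. c k z \<noteq> None} = 4" using dM[of z] lle[of z] by linarith
    then have "{k\<in>?L. c k z \<noteq> None} = ?L"
      using cL fin by (intro card_subset_eq) auto
    then show ?thesis by blast
  qed
  have L: "i1 \<in> ?L" "i0 \<in> ?L" using i1(1,4) i0(1,4) by (auto simp: rest_def)
  \<comment> \<open>Degree 5 is tight on this side, so a low variable occurs in all four lost
    clauses, among them \<open>i1\<close> and \<open>i0\<close>.\<close>
  have low_M': "z = w \<or> z = y \<and> y0 = y" if "z \<in> ?W" "deg ?M h z \<le> 5" for z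
  proof -
    have "z \<in> {v, w, y}" "z \<in> {v, w, y0}"
      unfolding i1(5)[symmetric] i0(5)[symmetric] domIff using low_M[OF that] L by blast+
    then show ?thesis using that(1) by blast
  qed
  obtain z where z: "z \<in> ?W" "deg ?M h z \<le> 5"
    using boundedD[OF bounded_le_5[of 3] h(1) _] W0 cM by auto
  \<comment> \<open>Another splitting gives a second low variable, of degree at most
    \<open>2 + 3\<close> or \<open>0 + 4\<close>. With only \<open>w\<close> and \<open>y\<close>
    eligible, this forces \<open>y0 = y\<close>.\<close>
  have "\<exists>z'\<in>?W. z' \<noteq> z \<and> deg ?M h z' \<le> 5"
  proof -
    have z5: "deg ?M h z = 5" using degM[OF z(1)] z(2) by linarith
    then have pos: "occ ?M h z b \<ge> 1" for b using mu_occ_pos[OF h(1)] by simp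
    have sum: "occ ?M h z b + occ ?M h z (\<not> b) = 5" for b using deg_eq_occ[OF finM, of h z b] z5 by simp
    have "occ ?M h z True \<ge> 3 \<or> occ ?M h z False \<ge> 3" using sum[of True] by auto
    then obtain b where b: "occ ?M h z b \<ge> 3" by blast
    then consider "occ ?M h z b = 3" | "occ ?M h z b = 4" using pos[of "\<not> b"] sum[of b] by linarith
    then show ?thesis
    proof cases
      case 1
      then have "card ?M + 1 \<le> card ?W + 1 + occ ?M h z b" using cM by linarith
      moreover have "?W \<noteq> {z}" using VW V3 by fastforce
      ultimately obtain z' where z': "z' \<in> ?W" "z' \<noteq> z" "deg (rest ?M h z b) h z' \<le> 2"
        using split_low[OF bounded_1 h z(1)] by blast
      have "deg ?M h z' \<le> 5" using deg_rest_le[OF finM, of h z' z b] z'(3) 1 by linarith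
      then show ?thesis using z' by blast
    next
      case 2
      then have "card ?M + 1 \<le> card ?W + 0 + occ ?M h z b" using cM by linarith
      then obtain z' where z': "z' \<in> ?W" "z' \<noteq> z" "deg (rest ?M h z b) h z' \<le> 0"
        using split_low[OF tarsi h z(1)] by blast
      have "deg ?M h z' \<le> 5" using deg_rest_le[OF finM, of h z' z b] z'(3) 2 by linarith
      then show ?thesis using z' by blast
    qed
  qed
  then obtain z' where z': "z' \<in> ?W" "z' \<noteq> z" "deg ?M h z' \<le> 5" by blast
  have y0: "y0 = y" using low_M'[OF z] low_M'[OF z'(1,3)] z'(2) by blast

  \<comment> \<open>Satisfying the two clauses with \<open>Some True\<close> at \<open>w\<close>
    turns \<open>i0\<close> into a unit clause on \<open>y\<close>; propagation leaves deficiency at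
    most 1. A low variable there has degree at most \<open>2 + 1\<close> in \<open>?J\<close>,
    because \<open>i1\<close>, one of the two satisfied clauses, lacks it.\<close>
  let ?N = "rest ?J g w True" and ?U = "?W - {w}"
  have muN: "mu ?N ?U (strip g w)" using saturated_split[OF g w(1)] .
  have i0N: "i0 \<in> ?N" using i0(1,3) by (simp add: rest_def)
  have "dom (strip g w i0) = {y}" using i0(2,6) y0 by (auto simp: strip_def)
  then obtain b where "strip g w i0 = [y \<mapsto> b]" unfolding dom_eq_singleton_conv by blast
  from mu_unit_propagation(1)[OF muN i0N this]
  have muP: "mu (?N - {i0}) (?U - {y}) (strip (strip g w) y)" .
  have o2: "occ ?J g w True = 2" using deficiency_2_occ[OF g cJ deg_g w] .
  have "card ?N + 2 = card ?J" using card_rest[OF finJ, of g w True] o2 by simp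
  moreover have "card ?N = card (?N - {i0}) + 1" using card_minus[OF finite_rest[OF finJ] i0N] .
  moreover have W2: "card ?W = card (?U - {y}) + 2"
    using card_minus[of ?W w] card_minus[of ?U y] fin w(1) i1(2) by simp
  ultimately have cP: "card (?N - {i0}) \<le> card (?U - {y}) + 1" using cJ by linarith
  show False
  proof (cases "?U - {y} = {}")
    case False
    then obtain x where x: "x \<in> ?U - {y}" "deg (?N - {i0}) (strip (strip g w) y) x \<le> 2"
      using boundedD[OF bounded_1 muP] cP by blast
    have dx: "deg (?N - {i0}) g x \<le> 2" using x by (simp add: deg_strip)
    have "x \<notin> dom (g i1)" "x \<notin> dom (g i0)" unfolding i1(6) i0(6) using x(1) y0 by blast+
    then have "g i1 x = None" "g i0 x = None" by (simp_all add: domIff)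
    then have "{k\<in>?J. g k x \<noteq> None} \<subseteq>
        {k\<in>?N - {i0}. g k x \<noteq> None} \<union> ({k\<in>?J. g k w = Some True} - {i1})"
      by (auto simp: rest_def)
    then have "deg ?J g x \<le> card ({k\<in>?N - {i0}. g k x \<noteq> None} \<union> ({k\<in>?J. g k w = Some True} - {i1}))"
      unfolding deg_def using finJ finite_rest[OF finJ, of g w True] by (intro card_mono) auto
    also have "\<dots> \<le> deg (?N - {i0}) g x + card ({k\<in>?J. g k w = Some True} - {i1})"
      unfolding deg_def by (rule card_Un_le)
    also have "card ({k\<in>?J. g k w = Some True} - {i1}) = 1"
      using card_minus[of "{k\<in>?J. g k w = Some True}" i1] o2 finJ i1(1,3) by (simp add: occ_def)
    finally have "deg ?J g x \<le> 3" using dx by linarith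
    moreover have "4 \<le> deg ?J g x" using deg_g x(1) by blast
    ultimately show False by linarith
  next
    case True
    \<comment> \<open>Without further variables, the five clauses of \<open>?K\<close> agree at
      \<open>v\<close> and all contain \<open>w\<close> and \<open>y\<close>, for which there are
      only four sign patterns.\<close>
    then have WE: "?W = {w, y}" using w(1) i1(2) by blast
    have "i = j" if "i \<in> ?K" "j \<in> ?K" "(the (c i w), the (c i y)) = (the (c j w), the (c j y))" for i j
    proof -
      have "c i w \<noteq> None" "c j w \<noteq> None" "c i y \<noteq> None" "c j y \<noteq> None"
        using low_J[OF w] low_J[of y] i1(2,7) that(1,2) by blast+
      then have eq: "c i w = c j w" "c i y = c j y" "c i v = c j v" using that by auto
      have "dom (c i) \<subseteq> {v, w, y}" using muD(3)[OF mu(1), of i] that(1) WE by blast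
      then have "c i \<subseteq>\<^sub>m c j" using eq unfolding map_le_def by blast
      then show ?thesis using mu_subsume[OF mu(1)] that(1,2) by blast
    qed
    then have "inj_on (\<lambda>i. (the (c i w), the (c i y))) ?K" by (intro inj_onI) blast
    then have "card ?K \<le> card (UNIV :: (bool \<times> bool) set)" by (rule card_inj_on_le) auto
    then show False using cK by (simp add: card_UNIV_bool card_cartesian_product flip: UNIV_Times_UNIV)
  qed
qed

text \<open>Disposes of unit clauses: propagating one keeps the deficiency and the degrees of all
  other variables.\<close>

lemma no_min_degree_9:
  fixes I :: "'i set" and V :: "'v set"
  assumes "mu I V c" "V \<noteq> {}" "card I \<le> card V + 6" "\<forall>z\<in>V. 9 \<le> deg I c z"
  shows False
  using assms
proof (induction "card V" arbitrary: I V c rule: less_induct)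
  case less
  have fin: "finite I" "finite V" using muD[OF less.prems(1)] by auto
  obtain c' where c': "mu I V c'" "saturated I V c'" and le: "\<forall>i\<in>I. c i \<subseteq>\<^sub>m c' i"
    using exists_saturation[OF less.prems(1)] .
  have deg: "\<forall>z\<in>V. 9 \<le> deg I c' z"
    using less.prems(4) deg_mono[OF fin(1) le] order_trans by blast
  have "dom (c' i) \<noteq> {x}" if i: "i \<in> I" for i x
  proof
    assume d: "dom (c' i) = {x}"
    then obtain b where b: "c' i = [x \<mapsto> b]" unfolding dom_eq_singleton_conv by blast
    have x: "x \<in> V" using muD(3)[OF c'(1) i] d by blast
    have mu': "mu (I - {i}) (V - {x}) (strip c' x)" using mu_unit_propagation(1)[OF c'(1) i b] .
    have cV: "card V = card (V - {x}) + 1" using card_minus[OF fin(2) x] .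
    have V3: "card V \<ge> 3" using card_vars_ge_3[OF less.prems] .
    have cI: "card (I - {i}) \<le> card (V - {x}) + 6"
      using card_minus[OF fin(1) i] cV less.prems(3) by linarith
    have "\<forall>z\<in>V - {x}. 9 \<le> deg (I - {i}) (strip c' x) z"
    proof
      fix z assume z: "z \<in> V - {x}"
      then have "{k\<in>I. c' k z \<noteq> None} = {k\<in>I - {i}. c' k z \<noteq> None}" by (auto simp: b)
      then have "deg (I - {i}) (strip c' x) z = deg I c' z" using z by (simp add: deg_def strip_def)
      then show "9 \<le> deg (I - {i}) (strip c' x) z" using deg z by simp
    qed
    from less.hyps[OF _ mu' _ cI this] cV V3 show False by fastforce
  qed
  then show False using no_min_degree_9_core[OF c' less.prems(2,3) deg] by blast
qed

lemma bounded_6: "bounded TYPE('i \<times> 'v) 6 8"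
  unfolding bounded_def
proof (intro allI impI, rule ccontr)
  fix I :: "'i set" and V :: "'v set" and c
  assume "mu I V c" "V \<noteq> {} \<or> (6::nat) = 0" "card I \<le> card V + 6" "\<not> (\<exists>x\<in>V. deg I c x \<le> 8)"
  then show False using no_min_degree_9[of I V c] by fastforce
qed

lemma bounded_vdm_bound: "k \<le> 13 \<Longrightarrow> bounded TYPE('i \<times> 'v) k (vdm_bound k)"
  using bounded_le_13[OF bounded_6] .

section \<open>Full clauses\<close>

definition full :: "'i set \<Rightarrow> 'v set \<Rightarrow> ('i \<Rightarrow> 'v \<Rightarrow> bool option) \<Rightarrow> 'i set" where
  "full I V c = {i\<in>I. dom (c i) = V}"

lemma full_le_deg: "finite I \<Longrightarrow> x \<in> V \<Longrightarrow> card (full I V c) \<le> deg I c x"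
  unfolding full_def deg_def by (intro card_mono) auto

text \<open>Flip \<open>x\<close> in a private assignment of a clause containing \<open>x\<close>.
  The clause falsified then also contains \<open>x\<close>, hence is full, hence is the same clause
  with \<open>x\<close> negated.\<close>

lemma only_full_balanced:
  assumes mu: "mu I V c" and x: "x \<in> V" and full: "\<forall>i\<in>I. c i x \<noteq> None \<longrightarrow> dom (c i) = V"
  shows "occ I c x True = occ I c x False"
proof -
  have fin: "finite I" using muD[OF mu] by auto
  have inj: "inj_on c I"
  proof (rule inj_onI)
    fix i j assume "i \<in> I" "j \<in> I" "c i = c j"
    then show "i = j" using mu_subsume[OF mu] by auto
  qed
  have le: "occ I c x b \<le> occ I c x (\<not> b)" for b
  proof -
    let ?A = "c ` {i\<in>I. c i x = Some b}" and ?B = "c ` {i\<in>I. c i x = Some (\<not> b)}"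
    have "\<exists>j\<in>I. c j = (c i)(x \<mapsto> \<not> b)" if i: "i \<in> I" "c i x = Some b" for i
    proof -
      obtain f where f: "only_falsifies I c i f" using muD(5)[OF mu i(1)] by blast
      obtain j where j: "j \<in> I" "falsifies (f(x := \<not> b)) (c j)" using muD(4)[OF mu] by blast
      have "c j x \<noteq> None"
      proof
        assume none: "c j x = None"
        then have "falsifies f (c j)" using j(2) unfolding falsifies_def
          by (metis fun_upd_other option.distinct(1))
        then have "j = i" using f j(1) unfolding only_falsifies_def by blast
        then show False using none i(2) by simp
      qed
      then have dj: "dom (c j) = V" using full j(1) by blast
      have di: "dom (c i) = V" using full i by simp
      have "c j y = ((c i)(x \<mapsto> \<not> b)) y" for y
      proof (cases "y \<in> V")
        case True
        then obtain d e where de: "c j y = Some d" "c i y = Some e" using dj di by blast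
        then have "d = (f(x := \<not> b)) y" "e = f y"
          using falsifiesD[OF j(2)] f falsifiesD unfolding only_falsifies_def by metis+
        then show ?thesis using de by simp
      next
        case False
        then have "c j y = None" "c i y = None" "y \<noteq> x" using dj di x by auto
        then show ?thesis by simp
      qed
      then show ?thesis using j(1) by blast
    qed
    note partner = this
    have "(\<lambda>p. p(x \<mapsto> \<not> b)) ` ?A \<subseteq> ?B"
    proof
      fix p assume "p \<in> (\<lambda>p. p(x \<mapsto> \<not> b)) ` ?A"
      then obtain i where i: "i \<in> I" "c i x = Some b" "p = (c i)(x \<mapsto> \<not> b)" by blast
      then obtain j where "j \<in> I" "p = c j" using partner by metis
      moreover have "p x = Some (\<not> b)" using i(3) by simp
      ultimately show "p \<in> ?B" by simp
    qed
    moreover have "inj_on (\<lambda>p. p(x \<mapsto> \<not> b)) ?A"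
    proof (rule inj_onI)
      fix p q assume pq: "p \<in> ?A" "q \<in> ?A" "p(x \<mapsto> \<not> b) = q(x \<mapsto> \<not> b)"
      show "p = q"
      proof
        fix y show "p y = q y"
          using fun_cong[OF pq(3), of y] pq(1,2) by (cases "y = x") auto
      qed
    qed
    ultimately have "card ?A \<le> card ?B" using fin by (intro card_inj_on_le) auto
    moreover have "card ?A = occ I c x b" "card ?B = occ I c x (\<not> b)"
      unfolding occ_def by (intro card_image inj_on_subset[OF inj]; blast)+
    ultimately show ?thesis by simp
  qed
  show ?thesis using le[of True] le[of False] by simp
qed

text \<open>If the number of full clauses reaches the bound for the minimal degree, some variable
  occurs only in full clauses, and these come in pairs.\<close>

lemma many_full:
  fixes I :: "'i set" and V :: "'v set"
  assumes mu: "mu I V c" and ne: "V \<noteq> {}" and card: "card I \<le> card V + k"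
    and B: "bounded TYPE('i \<times> 'v) k b" and many: "card (full I V c) \<ge> b"
  obtains x where "x \<in> V" "deg I c x = b" "occ I c x True = occ I c x False"
    "\<forall>i\<in>I. c i x \<noteq> None \<longrightarrow> dom (c i) = V"
proof -
  have fin: "finite I" using muD[OF mu] by auto
  obtain x where x: "x \<in> V" "deg I c x \<le> b" using boundedD[OF B mu] ne card by blast
  have sub: "full I V c \<subseteq> {i\<in>I. c i x \<noteq> None}" using x(1) by (auto simp: full_def)
  have eq: "deg I c x = b" "card (full I V c) = deg I c x"
    using full_le_deg[OF fin x(1), of c] x(2) many by linarith+
  then have "full I V c = {i\<in>I. c i x \<noteq> None}"
    using fin by (intro card_subset_eq[OF _ sub]) (auto simp: deg_def)
  then have "\<forall>i\<in>I. c i x \<noteq> None \<longrightarrow> dom (c i) = V" unfolding full_def by blast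
  then show ?thesis using that[OF x(1) eq(1) only_full_balanced[OF mu x(1)]] by blast
qed

lemma full_less_odd:
  fixes I :: "'i set" and V :: "'v set"
  assumes "mu I V c" "V \<noteq> {}" "card I \<le> card V + k" "bounded TYPE('i \<times> 'v) k b" "odd b"
  shows "card (full I V c) < b"
proof (rule ccontr)
  assume "\<not> ?thesis"
  then have "card (full I V c) \<ge> b" by simp
  from many_full[OF assms(1-4) this] obtain x where x: "deg I c x = b" "occ I c x True = occ I c x False" .
  have "deg I c x = occ I c x True + occ I c x False"
    using deg_eq_occ[OF muD(1)[OF assms(1)], of c x True] by simp
  then show False using x assms(5) by simp
qed

text \<open>With ten full clauses some \<open>x\<close> occurs five times with each sign and only in
  full clauses. Satisfying one sign leaves five full clauses in deficiency
  \<open>7 - 5 + 1 = 3\<close>, where the odd bound 5 is not reached.\<close>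

lemma full_le_9:
  fixes I :: "'i set" and V :: "'v set"
  assumes mu0: "mu I V c0" and ne: "V \<noteq> {}" and card: "card I \<le> card V + 7"
  shows "card (full I V c0) \<le> 9"
proof (rule ccontr)
  assume "\<not> ?thesis"
  then have many0: "card (full I V c0) \<ge> 10" by simp
  obtain c where mu: "mu I V c" "saturated I V c" and le: "\<forall>i\<in>I. c0 i \<subseteq>\<^sub>m c i"
    using exists_saturation[OF mu0] .
  have fin: "finite I" "finite V" using muD[OF mu(1)] by auto
  have "full I V c0 \<subseteq> full I V c"
    unfolding full_def using le muD(3)[OF mu(1)] map_le_implies_dom_le by blast
  then have many: "card (full I V c) \<ge> 10"
    using many0 card_mono[of "full I V c" "full I V c0"] fin by (simp add: full_def)
  have "bounded TYPE('i \<times> 'v) 7 10" using bounded_vdm_bound[of 7] by simp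
  from many_full[OF mu(1) ne card this many] obtain x
    where x: "x \<in> V" "deg I c x = 10" "occ I c x True = occ I c x False"
      "\<forall>i\<in>I. c i x \<noteq> None \<longrightarrow> dom (c i) = V" .
  have o: "occ I c x True = 5" "occ I c x False = 5"
    using x(2,3) deg_eq_occ[OF fin(1), of c x True] by auto
  let ?J = "rest I c x True" and ?W = "V - {x}"
  have muJ: "mu ?J ?W (strip c x)" using saturated_split[OF mu x(1)] .
  have "?W \<noteq> {}"
  proof
    assume "?W = {}"
    then have "V = {x}" using x(1) by blast
    then show False using single_var_deg[of I x c] mu(1) x(2) by simp
  qed
  moreover have "card ?J \<le> card ?W + 3"
    using card_rest[OF fin(1), of c x True] card_minus[OF fin(2) x(1)] card o(1) by linarith
  moreover have "bounded TYPE('i \<times> 'v) 3 5" using bounded_vdm_bound[of 3] by simp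
  ultimately have "card (full ?J ?W (strip c x)) < 5"
    using full_less_odd[OF muJ] by (metis odd_numeral)
  moreover have "{i\<in>I. c i x = Some False} \<subseteq> full ?J ?W (strip c x)"
  proof
    fix i assume i: "i \<in> {i\<in>I. c i x = Some False}"
    then have "dom (c i) = V" using x(4) by auto
    moreover have "dom (strip c x i) = dom (c i) - {x}" by (auto simp: strip_def)
    ultimately show "i \<in> full ?J ?W (strip c x)" using i by (auto simp: full_def rest_def)
  qed
  then have "occ I c x False \<le> card (full ?J ?W (strip c x))"
    unfolding occ_def using finite_rest[OF fin(1), of c x True] by (intro card_mono) (auto simp: full_def)
  ultimately show False using o(2) by linarith
qed

section \<open>Clause-sets\<close>

text \<open>A positive literal demands \<open>False\<close>, the value at which the clause fails. As
  a family, a clause-set is indexed by its own clauses.\<close>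

definition falsifier :: "'v lit set \<Rightarrow> 'v \<Rightarrow> bool option" where
  "falsifier C v = (if Pos v \<in> C then Some False else if Neg v \<in> C then Some True else None)"

fun lit_true :: "('v \<Rightarrow> bool) \<Rightarrow> 'v lit \<Rightarrow> bool" where
  "lit_true f (Pos v) = f v"
| "lit_true f (Neg v) = (\<not> f v)"

lemma lit_true_compl [simp]: "lit_true f (compl x) \<longleftrightarrow> \<not> lit_true f x"
  by (cases x) auto

lemma is_clauseD: "is_clause C \<Longrightarrow> x \<in> C \<Longrightarrow> compl x \<notin> C"
  by (simp add: is_clause_def)

lemma dom_falsifier: "dom (falsifier C) = clause_vars C"
proof -
  have "v \<in> clause_vars C \<longleftrightarrow> Pos v \<in> C \<or> Neg v \<in> C" for v
  proof
    assume "v \<in> clause_vars C"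
    then obtain x where "x \<in> C" "v = lit_var x" by (auto simp: clause_vars_def)
    then show "Pos v \<in> C \<or> Neg v \<in> C" by (cases x) auto
  next
    assume "Pos v \<in> C \<or> Neg v \<in> C"
    then show "v \<in> clause_vars C"
      using imageI[of "Pos v" C lit_var] imageI[of "Neg v" C lit_var] by (auto simp: clause_vars_def)
  qed
  moreover have "v \<in> dom (falsifier C) \<longleftrightarrow> Pos v \<in> C \<or> Neg v \<in> C" for v
    by (simp add: falsifier_def domIff del: not_None_eq)
  ultimately show ?thesis by blast
qed

lemma falsifies_falsifier:
  assumes "is_clause C"
  shows "falsifies f (falsifier C) \<longleftrightarrow> (\<forall>x\<in>C. \<not> lit_true f x)"
proof
  assume f: "falsifies f (falsifier C)"
  show "\<forall>x\<in>C. \<not> lit_true f x"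
  proof
    fix x assume x: "x \<in> C"
    show "\<not> lit_true f x"
    proof (cases x)
      case (Pos v)
      then have "falsifier C v = Some False" using x by (simp add: falsifier_def)
      then show ?thesis using falsifiesD[OF f] Pos by auto
    next
      case (Neg v)
      then have "Pos v \<notin> C" using is_clauseD[OF assms x] by simp
      then have "falsifier C v = Some True" using x Neg by (simp add: falsifier_def)
      then show ?thesis using falsifiesD[OF f] Neg by auto
    qed
  qed
next
  assume f: "\<forall>x\<in>C. \<not> lit_true f x"
  show "falsifies f (falsifier C)"
    unfolding falsifies_def
  proof (intro allI impI)
    fix v b assume b: "falsifier C v = Some b"
    show "f v = b"
    proof (cases "Pos v \<in> C")
      case True
      then show ?thesis using bspec[OF f True] b by (simp add: falsifier_def)
    next
      case False
      then have "Neg v \<in> C" "b" using b by (auto simp: falsifier_def split: if_splits)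
      then show ?thesis using bspec[OF f, of "Neg v"] by simp
    qed
  qed
qed

lemma finite_vars: "is_clause_set F \<Longrightarrow> finite (vars F)"
  by (auto simp: is_clause_set_def is_clause_def vars_def clause_vars_def)

lemma satisfiable_iff:
  assumes "is_clause_set F"
  shows "satisfiable F \<longleftrightarrow> (\<exists>f. \<forall>C\<in>F. \<exists>x\<in>C. lit_true f x)"
proof
  assume "satisfiable F"
  then obtain C where C: "is_clause C" "\<forall>D\<in>F. C \<inter> D \<noteq> {}" unfolding satisfiable_def by blast
  have "lit_true (\<lambda>v. Pos v \<in> C) x" if "x \<in> C" for x
    using is_clauseD[OF C(1) that] that by (cases x) simp_all
  then have "\<forall>D\<in>F. \<exists>x\<in>D. lit_true (\<lambda>v. Pos v \<in> C) x" using C(2) by fast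
  then show "\<exists>f. \<forall>C\<in>F. \<exists>x\<in>C. lit_true f x" by blast
next
  assume "\<exists>f. \<forall>C\<in>F. \<exists>x\<in>C. lit_true f x"
  then obtain f where f: "\<forall>C\<in>F. \<exists>x\<in>C. lit_true f x" by blast
  \<comment> \<open>Restricting to literals of \<open>F\<close> keeps the satisfying clause
    finite.\<close>
  let ?C = "{x \<in> \<Union>F. lit_true f x}"
  have "finite (\<Union>F)" using assms by (auto simp: is_clause_set_def is_clause_def)
  then have "finite ?C" by (rule rev_finite_subset) blast
  then have "is_clause ?C" by (simp add: is_clause_def)
  moreover have "?C \<inter> D \<noteq> {}" if D: "D \<in> F" for D
    using bspec[OF f D] D by blast
  ultimately show "satisfiable F" unfolding satisfiable_def by fast
qed

lemma unsatisfiable_iff: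
  assumes "is_clause_set F"
  shows "\<not> satisfiable F \<longleftrightarrow> (\<forall>f. \<exists>C\<in>F. falsifies f (falsifier C))"
proof -
  have "falsifies f (falsifier C) \<longleftrightarrow> \<not> (\<exists>x\<in>C. lit_true f x)" if "C \<in> F" for C f
    using falsifies_falsifier[of C f] that assms by (simp add: is_clause_set_def)
  then have "(\<exists>C\<in>F. falsifies f (falsifier C)) \<longleftrightarrow> \<not> (\<forall>C\<in>F. \<exists>x\<in>C. lit_true f x)" for f
    by simp
  then show ?thesis by (simp add: satisfiable_iff[OF assms])
qed

lemma is_clause_set_subset: "is_clause_set F \<Longrightarrow> G \<subseteq> F \<Longrightarrow> is_clause_set G"
  unfolding is_clause_set_def using finite_subset by blast

section \<open>Passage between clause-sets and families\<close>

lemma MU_imp_mu: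
  assumes "F \<in> MU"
  shows "mu F (vars F) falsifier"
proof -
  have cs: "is_clause_set F" and unsat: "\<not> satisfiable F" and min: "\<And>G. G \<subset> F \<Longrightarrow> satisfiable G"
    using assms by (auto simp: MU_def)
  have "\<exists>f. only_falsifies F falsifier C f" if C: "C \<in> F" for C
  proof -
    have "satisfiable (F - {C})" using min C by blast
    then have "\<not> (\<forall>f. \<exists>D\<in>F - {C}. falsifies f (falsifier D))"
      using unsatisfiable_iff[OF is_clause_set_subset[OF cs, of "F - {C}"]] by blast
    then obtain f where "\<forall>D\<in>F - {C}. \<not> falsifies f (falsifier D)" by blast
    moreover obtain D where "D \<in> F" "falsifies f (falsifier D)"
      using unsat unsatisfiable_iff[OF cs] by blast
    ultimately show ?thesis unfolding only_falsifies_def by (metis Diff_iff singletonD)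
  qed
  then show ?thesis
    unfolding mu_def using cs finite_vars[OF cs] unsat unsatisfiable_iff[OF cs]
    by (auto simp: dom_falsifier is_clause_set_def vars_def)
qed

lemma mu_imp_MU:
  assumes cs: "is_clause_set F" and mu: "mu F (vars F) falsifier"
  shows "F \<in> MU"
proof -
  have "satisfiable G" if G: "G \<subset> F" for G
  proof -
    obtain C where C: "C \<in> F" "C \<notin> G" using G by blast
    obtain f where "only_falsifies F falsifier C f" using muD(5)[OF mu C(1)] by blast
    then have "\<not> (\<exists>D\<in>G. falsifies f (falsifier D))"
      using G C(2) unfolding only_falsifies_def by blast
    then show ?thesis using unsatisfiable_iff[OF is_clause_set_subset[OF cs, of G]] G by blast
  qed
  then show ?thesis
    using cs muD(4)[OF mu] unsatisfiable_iff[OF cs] unfolding MU_def by blast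
qed

text \<open>An assignment falsifying \<open>C\<close> satisfies every clause that clashes with
  \<open>C\<close>, so it is private to \<open>C\<close>.\<close>

lemma UHIT_subset_MU:
  assumes "F \<in> UHIT"
  shows "F \<in> MU"
proof -
  have cs: "is_clause_set F" and unsat: "\<not> satisfiable F"
    and hit: "\<And>C D. C \<in> F \<Longrightarrow> D \<in> F \<Longrightarrow> C \<noteq> D \<Longrightarrow> \<exists>x\<in>C. compl x \<in> D"
    using assms by (auto simp: UHIT_def)
  have "\<exists>f. only_falsifies F falsifier C f" if C: "C \<in> F" for C
  proof -
    have cl: "is_clause D" if "D \<in> F" for D using cs that by (simp add: is_clause_set_def)
    define f where "f v = (Neg v \<in> C)" for v
    have fC: "\<not> lit_true f x" if "x \<in> C" for x
      using is_clauseD[OF cl[OF C] that] that by (cases x) (auto simp: f_def)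
    then have "falsifies f (falsifier C)" using falsifies_falsifier[OF cl[OF C]] by blast
    moreover have "D = C" if D: "D \<in> F" "falsifies f (falsifier D)" for D
    proof (rule ccontr)
      assume "D \<noteq> C"
      then obtain x where "x \<in> C" "compl x \<in> D" using hit[OF C D(1)] by metis
      then show False using fC falsifies_falsifier[OF cl[OF D(1)], of f] D(2) lit_true_compl by blast
    qed
    ultimately show ?thesis unfolding only_falsifies_def by blast
  qed
  then have "mu F (vars F) falsifier"
    unfolding mu_def using cs finite_vars[OF cs] unsat unsatisfiable_iff[OF cs]
    by (auto simp: dom_falsifier is_clause_set_def vars_def)
  then show ?thesis using mu_imp_MU[OF cs] by blast
qed

lemma var_degree_eq_deg: "var_degree F v = deg F falsifier v"
  unfolding var_degree_def deg_def dom_falsifier[symmetric] domIff by simp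

lemma fc_eq_full: "fc F = card (full F (vars F) falsifier)"
  by (simp add: fc_def full_def dom_falsifier)

section \<open>Upper bounds for clause-sets\<close>

lemma fc_le_min_var_degree:
  assumes "is_clause_set F" "vars F \<noteq> {}"
  shows "fc F \<le> min_var_degree F"
proof -
  have "finite F" using assms(1) by (simp add: is_clause_set_def)
  then show ?thesis
    unfolding min_var_degree_def using finite_vars[OF assms(1)] assms(2)
    by (auto simp: fc_eq_full var_degree_eq_deg full_le_deg)
qed

lemma vars_nonempty:
  assumes "F \<in> MU" "F \<noteq> {{}}"
  shows "vars F \<noteq> {}"
proof
  assume "vars F = {}"
  then have "F \<subseteq> {{}}" by (auto simp: vars_def clause_vars_def)
  moreover have "F \<noteq> {}" using mu_nonempty[OF MU_imp_mu[OF assms(1)]] .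
  ultimately show False using assms(2) by blast
qed

lemma min_var_degree_le:
  fixes F :: "'v lit set set"
  assumes F: "F \<in> MU" "F \<noteq> {{}}" and d: "deficiency F = int k" and k: "k \<le> 13"
  shows "min_var_degree F \<le> vdm_bound k"
proof -
  have mu: "mu F (vars F) falsifier" using MU_imp_mu[OF F(1)] .
  have "card F \<le> card (vars F) + k" using d by (simp add: deficiency_def)
  then obtain x where x: "x \<in> vars F" "var_degree F x \<le> vdm_bound k"
    using boundedD[OF bounded_vdm_bound[OF k] mu] vars_nonempty[OF F] by (auto simp: var_degree_eq_deg)
  have "min_var_degree F \<le> var_degree F x"
    unfolding min_var_degree_def using muD(2)[OF mu] x(1) by (intro Min_le) auto
  then show ?thesis using x(2) by simp
qed

text \<open>One less than \<open>vdm_bound\<close> at 3, 8 and 10, where that is odd, and at 7;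
  equal elsewhere.\<close>

definition fcm_bound :: "nat \<Rightarrow> nat" where
  "fcm_bound k = [0, 2, 4, 4, 6, 8, 8, 9, 10, 12, 12, 14, 16, 16] ! k"

lemma fc_le:
  fixes F :: "'v lit set set"
  assumes F: "F \<in> MU" and d: "deficiency F = int k" and k: "k \<le> 13"
  shows "fc F \<le> fcm_bound k"
proof (cases "F = {{}}")
  case True
  then have "k = 1" using d by (simp add: deficiency_def vars_def clause_vars_def)
  moreover have "fc F \<le> card F"
    unfolding fc_def using True by (intro card_mono) auto
  ultimately show ?thesis using True by (simp add: fcm_bound_def)
next
  case False
  have mu: "mu F (vars F) falsifier" using MU_imp_mu[OF F] .
  have cs: "is_clause_set F" using F by (simp add: MU_def)
  have ne: "vars F \<noteq> {}" using vars_nonempty[OF F False] .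
  have card: "card F \<le> card (vars F) + k" using d by (simp add: deficiency_def)
  have le: "fc F \<le> vdm_bound k"
    using fc_le_min_var_degree[OF cs ne] min_var_degree_le[OF F False d k] by linarith
  have odd: "fc F < vdm_bound k" if "odd (vdm_bound k)"
    using full_less_odd[OF mu ne card bounded_vdm_bound[OF k] that] by (simp add: fc_eq_full)
  have seven: "fc F \<le> 9" if "k = 7"
    using full_le_9[OF mu ne] card that by (simp add: fc_eq_full)
  have "k = 0 \<or> k = 1 \<or> k = 2 \<or> k = 3 \<or> k = 4 \<or> k = 5 \<or> k = 6 \<or> k = 7 \<or> k = 8 \<or> k = 9
    \<or> k = 10 \<or> k = 11 \<or> k = 12 \<or> k = 13" using k by presburger
  then show ?thesis
    using le odd seven by (elim disjE) (auto simp: fcm_bound_def vdm_bound_def)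
qed

text \<open>The falsifying assignments of the clauses of an unsatisfiable hitting clause-set partition
  the cube, and exactly the full clauses contribute an odd number of them.\<close>

lemma even_fc:
  assumes F: "F \<in> UHIT" and ne: "vars F \<noteq> {}"
  shows "even (fc F)"
proof -
  have cs: "is_clause_set F" and unsat: "\<not> satisfiable F"
    and hit: "\<And>C D. C \<in> F \<Longrightarrow> D \<in> F \<Longrightarrow> C \<noteq> D \<Longrightarrow> \<exists>x\<in>C. compl x \<in> D"
    using F by (auto simp: UHIT_def)
  have cl: "is_clause C" if "C \<in> F" for C using cs that by (simp add: is_clause_set_def)
  have fin: "finite F" "finite (vars F)" using cs finite_vars[OF cs] by (simp_all add: is_clause_set_def)
  define A where "A C = {X \<in> Pow (vars F). falsifies (\<lambda>v. v \<in> X) (falsifier C)}" for C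
  have sub: "clause_vars C \<subseteq> vars F" if "C \<in> F" for C using that by (auto simp: vars_def)
  have card_A: "card (A C) = 2 ^ card (vars F - clause_vars C)" if C: "C \<in> F" for C
  proof -
    let ?T = "{v. falsifier C v = Some True}" and ?U = "vars F - clause_vars C"
    have T: "?T \<subseteq> clause_vars C" by (auto simp flip: dom_falsifier)
    have "A C = (\<lambda>Y. Y \<union> ?T) ` Pow ?U"
    proof
      show "A C \<subseteq> (\<lambda>Y. Y \<union> ?T) ` Pow ?U"
      proof
        fix X assume X: "X \<in> A C"
        then have XV: "X \<subseteq> vars F" and f: "falsifies (\<lambda>v. v \<in> X) (falsifier C)" by (auto simp: A_def)
        have "v \<in> X \<longleftrightarrow> v \<in> ?T" if v: "v \<in> clause_vars C" for v
        proof -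
          obtain b where b: "falsifier C v = Some b" using v unfolding dom_falsifier[symmetric] by blast
          then show ?thesis using falsifiesD[OF f b] by simp
        qed
        then have "X = (X - clause_vars C) \<union> ?T" using T by blast
        moreover have "X - clause_vars C \<in> Pow ?U" using XV by blast
        ultimately show "X \<in> (\<lambda>Y. Y \<union> ?T) ` Pow ?U" by (rule image_eqI)
      qed
      show "(\<lambda>Y. Y \<union> ?T) ` Pow ?U \<subseteq> A C"
      proof
        fix X assume "X \<in> (\<lambda>Y. Y \<union> ?T) ` Pow ?U"
        then obtain Y where Y: "Y \<subseteq> ?U" "X = Y \<union> ?T" by blast
        have "(v \<in> X) = b" if b: "falsifier C v = Some b" for v b
        proof -
          have "v \<in> clause_vars C" using b by (auto simp flip: dom_falsifier)
          then have "v \<notin> Y" using Y(1) by blast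
          then show ?thesis using b Y(2) by simp
        qed
        moreover have "X \<subseteq> vars F" using Y T sub[OF C] by blast
        ultimately show "X \<in> A C" by (simp add: A_def falsifies_def)
      qed
    qed
    moreover have "inj_on (\<lambda>Y. Y \<union> ?T) (Pow ?U)"
      using T by (intro inj_onI) blast
    ultimately show ?thesis using fin by (simp add: card_image card_Pow)
  qed
  have "Pow (vars F) = (\<Union>C\<in>F. A C)"
  proof
    show "Pow (vars F) \<subseteq> (\<Union>C\<in>F. A C)"
    proof
      fix X assume X: "X \<in> Pow (vars F)"
      obtain C where "C \<in> F" "falsifies (\<lambda>v. v \<in> X) (falsifier C)"
        using unsat unsatisfiable_iff[OF cs] by blast
      then show "X \<in> (\<Union>C\<in>F. A C)" using X by (auto simp: A_def)
    qed
  qed (auto simp: A_def)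
  moreover have "A C \<inter> A D = {}" if CD: "C \<in> F" "D \<in> F" "C \<noteq> D" for C D
  proof -
    obtain x where x: "x \<in> C" "compl x \<in> D" using hit[OF CD] by blast
    have False if "X \<in> A C" "X \<in> A D" for X
    proof -
      have "\<not> lit_true (\<lambda>v. v \<in> X) x" "\<not> lit_true (\<lambda>v. v \<in> X) (compl x)"
        using that falsifies_falsifier[OF cl[OF CD(1)]] falsifies_falsifier[OF cl[OF CD(2)]] x
        unfolding A_def by blast+
      then show False by simp
    qed
    then show ?thesis by blast
  qed
  moreover have "finite (A C)" for C using fin(2) by (simp add: A_def)
  ultimately have "card (Pow (vars F)) = (\<Sum>C\<in>F. card (A C))"
    using card_UN_disjoint[of F A] fin(1) by simp
  moreover have "even (card (Pow (vars F)))" using fin ne by (simp add: card_Pow card_gt_0_iff)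
  ultimately have "even (card {C\<in>F. odd (card (A C))})" using even_sum_iff[OF fin(1)] by metis
  moreover have "odd (card (A C)) \<longleftrightarrow> clause_vars C = vars F" if "C \<in> F" for C
    using card_A[OF that] sub[OF that] fin(2) by auto
  then have "{C\<in>F. odd (card (A C))} = {C\<in>F. clause_vars C = vars F}" by blast
  ultimately show ?thesis by (simp add: fc_def)
qed

section \<open>Lower bounds by expanding full clauses\<close>

lemma expansion:
  fixes F :: "'v::infinite lit set set"
  assumes F: "F \<in> UHIT" and d: "deficiency F = int k" and r: "1 \<le> r" "r \<le> fc F"
  shows "\<exists>F' :: 'v lit set set. F' \<in> UHIT \<and> deficiency F' = int (k + r - 1) \<and> 2 * r \<le> fc F'"
proof -
  have cs: "is_clause_set F" and unsat: "\<not> satisfiable F"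
    and hit: "\<And>C D. C \<in> F \<Longrightarrow> D \<in> F \<Longrightarrow> C \<noteq> D \<Longrightarrow> \<exists>x\<in>C. compl x \<in> D"
    using F by (auto simp: UHIT_def)
  have cl: "is_clause C" if "C \<in> F" for C using cs that by (simp add: is_clause_set_def)
  have fin: "finite F" "finite (vars F)" using cs finite_vars[OF cs] by (simp_all add: is_clause_set_def)
  obtain R where R: "R \<subseteq> {C\<in>F. clause_vars C = vars F}" "card R = r"
    using obtain_subset_with_card_n[OF r(2)[unfolded fc_def]] by blast
  have RF: "R \<subseteq> F" and Rv: "\<And>C. C \<in> R \<Longrightarrow> clause_vars C = vars F" using R(1) by blast+
  have finR: "finite R" using RF fin(1) finite_subset by blast
  obtain v where v: "v \<notin> vars F" using ex_new_if_finite[OF infinite_UNIV fin(2)] by blast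
  have lits: "lit_var x \<noteq> v" if "x \<in> C" "C \<in> F" for x C
    using that v by (auto simp: vars_def clause_vars_def)
  have vn: "Pos v \<notin> C" "Neg v \<notin> C" if "C \<in> F" for C using lits[OF _ that] by fastforce+
  let ?P = "insert (Pos v) ` R" and ?N = "insert (Neg v) ` R"
  \<comment> \<open>Doubling the chosen clauses adds \<open>r\<close> clauses and one variable. The
    two copies clash in \<open>v\<close>, all other pairs clash as before; full clauses outside
    \<open>R\<close> are kept but lack \<open>v\<close>.\<close>
  define F' where "F' = (F - R) \<union> (?P \<union> ?N)"
  have F'E: "\<exists>C\<in>F. D = C \<and> C \<notin> R \<or> C \<in> R \<and> (D = insert (Pos v) C \<or> D = insert (Neg v) C)"
    if "D \<in> F'" for D
    using that RF by (auto simp: F'_def)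
  have inj: "inj_on (insert l) R" if "l = Pos v \<or> l = Neg v" for l
    using that vn RF by (intro inj_onI) (metis insert_ident subsetD)
  have "?P \<inter> ?N = {}" using vn RF by (auto; metis insertE insertI1 lit.distinct(1) subsetD)
  then have card_PN: "card (?P \<union> ?N) = 2 * r"
    using finR R(2) inj by (simp add: card_Un_disjoint card_image)
  have "(F - R) \<inter> (?P \<union> ?N) = {}" using vn by blast
  then have "card F' = card (F - R) + 2 * r"
    unfolding F'_def using fin(1) finR card_PN by (simp add: card_Un_disjoint)
  moreover have "card F = card (F - R) + r"
    using card_Un_disjoint[of "F - R" R] fin(1) finR R(2) RF by (simp add: Un_absorb2 Diff_disjoint Int_commute)
  ultimately have cF': "card F' = card F + r" by linarith
  have full: "clause_vars D = insert v (vars F)" if "D \<in> ?P \<union> ?N" for D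
    using that Rv by (auto simp: clause_vars_def)
  have "R \<noteq> {}" using R(2) r(1) by auto
  then obtain C0 where "C0 \<in> R" by blast
  have vF': "vars F' = insert v (vars F)"
  proof
    show "vars F' \<subseteq> insert v (vars F)"
    proof
      fix u assume "u \<in> vars F'"
      then obtain D where D: "D \<in> F'" "u \<in> clause_vars D" by (auto simp: vars_def)
      show "u \<in> insert v (vars F)"
      proof (cases "D \<in> ?P \<union> ?N")
        case True
        then show ?thesis using full D(2) by blast
      next
        case False
        then have "D \<in> F" using D(1) by (simp add: F'_def)
        then show ?thesis using D(2) by (auto simp: vars_def)
      qed
    qed
    have "insert (Pos v) C0 \<in> F'" "insert (Pos v) C0 \<in> ?P \<union> ?N" using \<open>C0 \<in> R\<close> by (auto simp: F'_def)
    then show "insert v (vars F) \<subseteq> vars F'" unfolding vars_def[of F'] using full by blast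
  qed
  have clF': "is_clause D" if D: "D \<in> F'" for D
  proof -
    have "is_clause (insert l C)" if "C \<in> F" "l = Pos v \<or> l = Neg v" for C l
    proof -
      have "compl x \<noteq> l" if "x \<in> C" for x
        using lits[OF that \<open>C \<in> F\<close>] \<open>l = Pos v \<or> l = Neg v\<close> by (cases x) auto
      then show ?thesis
        using cl[OF that(1)] vn[OF that(1)] that(2) unfolding is_clause_def by auto
    qed
    then show ?thesis using F'E[OF D] cl by blast
  qed
  have finF': "finite F'" using fin(1) finR by (simp add: F'_def)
  have csF': "is_clause_set F'" using clF' finF' by (simp add: is_clause_set_def)
  have "\<not> satisfiable F'"
    unfolding unsatisfiable_iff[OF csF']
  proof
    fix f
    obtain C where C: "C \<in> F" "falsifies f (falsifier C)" using unsat unsatisfiable_iff[OF cs] by blast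
    then have false: "\<not> lit_true f x" if "x \<in> C" for x using falsifies_falsifier[OF cl] that by blast
    show "\<exists>D\<in>F'. falsifies f (falsifier D)"
    proof (cases "C \<in> R")
      case False
      then show ?thesis using C by (auto simp: F'_def)
    next
      case True
      define D where "D = insert (if f v then Neg v else Pos v) C"
      have "D \<in> F'" using True by (auto simp: F'_def D_def)
      moreover have "\<forall>x\<in>D. \<not> lit_true f x" using false by (auto simp: D_def)
      ultimately show ?thesis using falsifies_falsifier[OF clF'] by blast
    qed
  qed
  moreover have "\<exists>x\<in>D. compl x \<in> E" if DE: "D \<in> F'" "E \<in> F'" "D \<noteq> E" for D E
  proof -
    obtain C where C: "C \<in> F" "D = C \<and> C \<notin> R \<or> C \<in> R \<and> (D = insert (Pos v) C \<or> D = insert (Neg v) C)"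
      using F'E[OF DE(1)] by blast
    obtain B where B: "B \<in> F" "E = B \<and> B \<notin> R \<or> B \<in> R \<and> (E = insert (Pos v) B \<or> E = insert (Neg v) B)"
      using F'E[OF DE(2)] by blast
    show ?thesis
    proof (cases "C = B")
      case True
      then have "D = insert (Pos v) C \<and> E = insert (Neg v) C \<or> D = insert (Neg v) C \<and> E = insert (Pos v) C"
        using C(2) B(2) DE(3) by blast
      then show ?thesis by force
    next
      case False
      then obtain x where "x \<in> C" "compl x \<in> B" using hit[OF C(1) B(1)] by blast
      then show ?thesis using C(2) B(2) by blast
    qed
  qed
  ultimately have "F' \<in> UHIT" using csF' by (simp add: UHIT_def)
  moreover have "deficiency F' = int (k + r - 1)"
    using d cF' vF' v fin r(1) by (simp add: deficiency_def)
  moreover have "2 * r \<le> fc F'"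
    unfolding fc_def card_PN[symmetric]
  proof (rule card_mono)
    show "finite {C \<in> F'. clause_vars C = vars F'}" using finF' by simp
    show "?P \<union> ?N \<subseteq> {C \<in> F'. clause_vars C = vars F'}" using full vF' unfolding F'_def by blast
  qed
  ultimately show ?thesis by blast
qed

lemma uhit_deficiency_1:
  shows "\<exists>F :: 'v lit set set. F \<in> UHIT \<and> deficiency F = int 1 \<and> 2 \<le> fc F"
proof -
  fix v :: 'v
  let ?F = "{{Pos v}, {Neg v}}"
  have cs: "is_clause_set ?F" by (simp add: is_clause_set_def is_clause_def)
  have "\<not> satisfiable ?F" unfolding satisfiable_iff[OF cs] by simp
  then have "?F \<in> UHIT" using cs by (simp add: UHIT_def)
  moreover have "{C \<in> ?F. clause_vars C = vars ?F} = ?F" by (auto simp: vars_def clause_vars_def)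
  then have "fc ?F = 2" unfolding fc_def by simp
  moreover have "deficiency ?F = int 1" by (simp add: deficiency_def vars_def clause_vars_def)
  ultimately show ?thesis by (intro exI[of _ ?F]) simp
qed

text \<open>The values of \<open>S2\<close> from 1 to 13; \<open>fcm_bound\<close> exceeds them only
  at 7.\<close>

definition fch_value :: "nat \<Rightarrow> nat" where
  "fch_value k = [0, 2, 4, 4, 6, 8, 8, 8, 10, 12, 12, 14, 16, 16] ! k"

lemma expansion_value:
  assumes "\<exists>F :: 'v::infinite lit set set. F \<in> UHIT \<and> deficiency F = int k \<and> b \<le> fc F"
    and "1 \<le> r" "r \<le> b" "k' = k + r - 1" "b' = 2 * r"
  shows "\<exists>F :: 'v lit set set. F \<in> UHIT \<and> deficiency F = int k' \<and> b' \<le> fc F"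
proof -
  obtain F :: "'v lit set set" where F: "F \<in> UHIT" "deficiency F = int k" "b \<le> fc F" using assms(1) by blast
  show ?thesis using expansion[OF F(1,2) assms(2)] F(3) assms(3-5) by simp
qed

lemma uhit_full_clauses:
  assumes "1 \<le> k" "k \<le> 13"
  shows "\<exists>F :: 'v::infinite lit set set. F \<in> UHIT \<and> deficiency F = int k \<and> fch_value k \<le> fc F"
proof -
  let ?E = "\<lambda>k b. \<exists>F :: 'v lit set set. F \<in> UHIT \<and> deficiency F = int k \<and> b \<le> fc F"
  have 1: "?E 1 2" by (rule uhit_deficiency_1)
  \<comment> \<open>The value \<open>2 * r\<close> at \<open>k'\<close> is obtained from
    \<open>k = k' - r + 1\<close>, where \<open>r\<close> full clauses are already
    available.\<close>
  have 2: "?E 2 4" by (rule expansion_value[OF 1, of 2]) simp_all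
  have 3: "?E 3 4" by (rule expansion_value[OF 2, of 2]) simp_all
  have 4: "?E 4 6" by (rule expansion_value[OF 2, of 3]) simp_all
  have 5: "?E 5 8" by (rule expansion_value[OF 2, of 4]) simp_all
  have 6: "?E 6 8" by (rule expansion_value[OF 3, of 4]) simp_all
  have 7: "?E 7 8" by (rule expansion_value[OF 4, of 4]) simp_all
  have 8: "?E 8 10" by (rule expansion_value[OF 4, of 5]) simp_all
  have 9: "?E 9 12" by (rule expansion_value[OF 4, of 6]) simp_all
  have 10: "?E 10 12" by (rule expansion_value[OF 5, of 6]) simp_all
  have 11: "?E 11 14" by (rule expansion_value[OF 5, of 7]) simp_all
  have 12: "?E 12 16" by (rule expansion_value[OF 5, of 8]) simp_all
  have 13: "?E 13 16" by (rule expansion_value[OF 6, of 8]) simp_all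
  have "k = 1 \<or> k = 2 \<or> k = 3 \<or> k = 4 \<or> k = 5 \<or> k = 6 \<or> k = 7 \<or> k = 8 \<or> k = 9
    \<or> k = 10 \<or> k = 11 \<or> k = 12 \<or> k = 13" using assms by presburger
  then show ?thesis
    using 1 2 3 4 5 6 7 8 9 10 11 12 13 by (elim disjE) (simp_all add: fch_value_def)
qed

section \<open>Covers of small cubes\<close>

fun full_clauses :: "nat \<Rightarrow> nat lit list list" where
  "full_clauses 0 = [[]]"
| "full_clauses (Suc n) = concat (map (\<lambda>C. [Pos n # C, Neg n # C]) (full_clauses n))"

text \<open>Full clauses are the points of the cube, and a shorter clause is the subcube of the full
  clauses containing it. All points missed by \<open>Ds\<close> are added, so the whole cube is
  covered.\<close>

definition complete_cube :: "nat \<Rightarrow> nat lit list list \<Rightarrow> nat lit set set" where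
  "complete_cube n Ds =
     set (map set (Ds @ filter (\<lambda>C. \<forall>D\<in>set Ds. \<not> set D \<subseteq> set C) (full_clauses n)))"

lemma ex_full_clause_false: "\<exists>C\<in>set (full_clauses n). \<forall>x\<in>set C. \<not> lit_true f x"
proof (induction n)
  case (Suc n)
  then obtain C where C: "C \<in> set (full_clauses n)" "\<forall>x\<in>set C. \<not> lit_true f x" by blast
  show ?case
    using C by (cases "f n") (auto intro!: bexI[of _ C])
qed simp

lemma is_clause_set_complete_cube:
  "\<forall>C\<in>complete_cube n Ds. \<forall>x\<in>C. compl x \<notin> C \<Longrightarrow> is_clause_set (complete_cube n Ds)"
  by (auto simp: is_clause_set_def is_clause_def complete_cube_def)

lemma complete_cube_unsatisfiable:
  assumes "is_clause_set (complete_cube n Ds)"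
  shows "\<not> satisfiable (complete_cube n Ds)"
proof -
  have "\<exists>C\<in>complete_cube n Ds. \<forall>x\<in>C. \<not> lit_true f x" for f
  proof -
    obtain C where C: "C \<in> set (full_clauses n)" "\<forall>x\<in>set C. \<not> lit_true f x"
      using ex_full_clause_false by blast
    show ?thesis
    proof (cases "\<exists>D\<in>set Ds. set D \<subseteq> set C")
      case True
      then obtain D where "D \<in> set Ds" "set D \<subseteq> set C" by blast
      then show ?thesis using C(2) by (intro bexI[of _ "set D"]) (auto simp: complete_cube_def)
    next
      case False
      then show ?thesis using C by (intro bexI[of _ "set C"]) (auto simp: complete_cube_def)
    qed
  qed
  then show ?thesis unfolding satisfiable_iff[OF assms] by meson
qed

definition hitting_cube :: "nat \<Rightarrow> nat lit list list \<Rightarrow> int \<Rightarrow> nat \<Rightarrow> bool" where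
  "hitting_cube n Ds k b \<longleftrightarrow> (let F = complete_cube n Ds in
     (\<forall>C\<in>F. \<forall>x\<in>C. compl x \<notin> C) \<and> (\<forall>C\<in>F. \<forall>D\<in>F. C \<noteq> D \<longrightarrow> (\<exists>x\<in>C. compl x \<in> D)) \<and>
     deficiency F = k \<and> vars F \<noteq> {} \<and> min_var_degree F = b)"

text \<open>Minimality is checked directly: each clause has a point \<open>E\<close> covered by no
  other clause.\<close>

definition irredundant_cube :: "nat \<Rightarrow> nat lit list list \<Rightarrow> int \<Rightarrow> nat \<Rightarrow> bool" where
  "irredundant_cube n Ds k b \<longleftrightarrow> (let F = complete_cube n Ds in
     (\<forall>C\<in>F. \<forall>x\<in>C. compl x \<notin> C) \<and>
     (\<forall>C\<in>F. \<exists>E\<in>set (full_clauses n). C \<subseteq> set E \<and> (\<forall>D\<in>F. D \<subseteq> set E \<longrightarrow> D = C)) \<and>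
     deficiency F = k \<and> fc F = b)"

text \<open>Two disjoint edges leave 4 of 8 points, giving 6 clauses; each variable occurs in the 4
  full clauses and in at least one edge.\<close>

lemma hitting_cube_3: "hitting_cube 3 [[Pos 1, Pos 2], [Neg 0, Neg 2]] (int 3) 5"
  by code_simp

text \<open>A square and two edges leave 8 of 16 points, giving 11 clauses; each variable occurs in
  two of the three short ones, so has degree \<open>8 + 2\<close>.\<close>

lemma hitting_cube_7:
  "hitting_cube 4 [[Pos 2, Pos 3], [Pos 0, Pos 1, Neg 3], [Neg 0, Neg 1, Neg 2]] (int 7) 10"
  by code_simp

text \<open>Four disjoint edges, one in each direction, leave 8 points: 12 clauses, and every
  variable has degree \<open>8 + 3\<close>.\<close>

lemma hitting_cube_8:
  "hitting_cube 4 [[Pos 1, Pos 2, Pos 3], [Neg 0, Neg 2, Neg 3], [Pos 0, Neg 1, Pos 3],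
     [Neg 0, Neg 1, Pos 2]] (int 8) 11"
  by code_simp

lemma hitting_cube_10: "hitting_cube 4 [[Pos 1, Pos 2, Pos 3], [Neg 0, Neg 2, Neg 3]] (int 10) 13"
  by code_simp

text \<open>Two squares meeting in one point leave 9 points. The overlap breaks the hitting property
  and makes the number of full clauses odd.\<close>

lemma irredundant_cube_7: "irredundant_cube 4 [[Pos 2, Pos 3], [Pos 0, Pos 1]] (int 7) 9"
  by code_simp

section \<open>Transport along injective renamings\<close>

lemma compl_map_lit [simp]: "compl (map_lit g x) = map_lit g (compl x)"
  by (cases x) auto

lemma lit_var_map_lit [simp]: "lit_var (map_lit g x) = g (lit_var x)"
  by (cases x) auto

lemma lit_true_map_lit [simp]: "lit_true f (map_lit g x) \<longleftrightarrow> lit_true (f \<circ> g) x"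
  by (cases x) auto

definition rename :: "('a \<Rightarrow> 'b) \<Rightarrow> 'a lit set set \<Rightarrow> 'b lit set set" where
  "rename g F = (`) (map_lit g) ` F"

context
  fixes g :: "'a \<Rightarrow> 'b"
  assumes inj: "inj g"
begin

lemma inj_map_lit: "inj (map_lit g)"
  using lit.inj_map[OF inj] .

lemma inj_image_map_lit: "inj ((`) (map_lit g))"
  using inj_map_lit by (simp add: inj_on_image)

lemma clause_vars_rename: "clause_vars (map_lit g ` C) = g ` clause_vars C"
  by (auto simp: clause_vars_def image_image)

lemma vars_rename: "vars (rename g F) = g ` vars F"
  by (auto simp: vars_def rename_def clause_vars_rename)

lemma is_clause_set_rename: "is_clause_set F \<Longrightarrow> is_clause_set (rename g F)"
  using inj_map_lit
  by (auto simp: is_clause_set_def is_clause_def rename_def inj_image_mem_iff)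

lemma satisfiable_rename:
  assumes "is_clause_set F"
  shows "satisfiable (rename g F) \<longleftrightarrow> satisfiable F"
proof -
  have "(\<exists>f. \<forall>C\<in>F. \<exists>x\<in>C. lit_true (f \<circ> g) x) \<longleftrightarrow> (\<exists>f. \<forall>C\<in>F. \<exists>x\<in>C. lit_true f x)"
  proof
    assume "\<exists>f. \<forall>C\<in>F. \<exists>x\<in>C. lit_true f x"
    then obtain f where f: "\<forall>C\<in>F. \<exists>x\<in>C. lit_true f x" by meson
    have "(f \<circ> inv g) \<circ> g = f" using inj by (simp add: fun_eq_iff)
    then show "\<exists>f. \<forall>C\<in>F. \<exists>x\<in>C. lit_true (f \<circ> g) x" using f by (intro exI[of _ "f \<circ> inv g"]) simp
  next
    assume "\<exists>f. \<forall>C\<in>F. \<exists>x\<in>C. lit_true (f \<circ> g) x"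
    then obtain f where "\<forall>C\<in>F. \<exists>x\<in>C. lit_true (f \<circ> g) x" by meson
    then show "\<exists>f. \<forall>C\<in>F. \<exists>x\<in>C. lit_true f x" by (intro exI[of _ "f \<circ> g"])
  qed
  then show ?thesis
    unfolding satisfiable_iff[OF assms] satisfiable_iff[OF is_clause_set_rename[OF assms]]
    by (simp add: rename_def)
qed

lemma deficiency_rename: "deficiency (rename g F) = deficiency F"
proof -
  have "card (rename g F) = card F"
    unfolding rename_def using inj_image_map_lit by (intro card_image) (rule inj_on_subset, auto)
  moreover have "card (vars (rename g F)) = card (vars F)"
    unfolding vars_rename using inj by (intro card_image) (rule inj_on_subset, auto)
  ultimately show ?thesis by (simp add: deficiency_def)
qed

lemma UHIT_rename: "F \<in> UHIT \<Longrightarrow> rename g F \<in> UHIT"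
proof -
  assume F: "F \<in> UHIT"
  have "\<exists>x\<in>C. compl x \<in> D" if CD: "C \<in> rename g F" "D \<in> rename g F" "C \<noteq> D" for C D
  proof -
    obtain C' D' where C: "C' \<in> F" "C = map_lit g ` C'" and D: "D' \<in> F" "D = map_lit g ` D'"
      using CD(1,2) by (auto simp: rename_def)
    have "C' \<noteq> D'" using CD(3) C(2) D(2) by blast
    then obtain x where "x \<in> C'" "compl x \<in> D'"
      using F C(1) D(1) unfolding UHIT_def by blast
    then show ?thesis unfolding C(2) D(2) by (intro bexI[of _ "map_lit g x"]) auto
  qed
  then show ?thesis
    using F is_clause_set_rename satisfiable_rename unfolding UHIT_def by simp
qed

lemma MU_rename: "F \<in> MU \<Longrightarrow> rename g F \<in> MU"
proof -
  assume F: "F \<in> MU"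
  have cs: "is_clause_set F" using F by (simp add: MU_def)
  have "satisfiable G" if G: "G \<subset> rename g F" for G
  proof -
    define H where "H = {C\<in>F. map_lit g ` C \<in> G}"
    have eq: "G = rename g H"
    proof
      show "G \<subseteq> rename g H" using G by (auto simp: H_def rename_def)
      show "rename g H \<subseteq> G" by (auto simp: H_def rename_def)
    qed
    have "H \<subseteq> F" by (auto simp: H_def)
    moreover have "H \<noteq> F" using G eq by blast
    ultimately have "H \<subset> F" by blast
    then have "satisfiable H" using F by (simp add: MU_def)
    then show ?thesis
      using satisfiable_rename[OF is_clause_set_subset[OF cs \<open>H \<subseteq> F\<close>]] eq by simp
  qed
  then show ?thesis
    using F is_clause_set_rename satisfiable_rename unfolding MU_def by simp
qed

lemma card_rename_filter:
  assumes "\<And>C. C \<in> F \<Longrightarrow> P (map_lit g ` C) \<longleftrightarrow> Q C"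
  shows "card {C \<in> rename g F. P C} = card {C \<in> F. Q C}"
proof -
  have "{C \<in> rename g F. P C} = (`) (map_lit g) ` {C \<in> F. Q C}"
    using assms by (auto simp: rename_def)
  then show ?thesis
    using inj_image_map_lit by (simp add: card_image inj_on_subset)
qed

lemma fc_rename: "fc (rename g F) = fc F"
  unfolding fc_def vars_rename
  by (rule card_rename_filter) (simp add: clause_vars_rename inj_image_eq_iff[OF inj])

lemma min_var_degree_rename: "min_var_degree (rename g F) = min_var_degree F"
proof -
  have "var_degree (rename g F) (g v) = var_degree F v" for v
    unfolding var_degree_def
    by (rule card_rename_filter) (simp add: clause_vars_rename inj_image_mem_iff[OF inj])
  then show ?thesis by (simp add: min_var_degree_def vars_rename image_image)
qed

end

lemma ex_inj_nat: "\<exists>g :: nat \<Rightarrow> 'v::infinite. inj g"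
  using infinite_countable_subset[OF infinite_UNIV] by blast

section \<open>From checked covers to witnesses over any infinite type\<close>

lemma hitting_cube_min_var_degree:
  assumes "hitting_cube n Ds (int k) b"
  shows "\<exists>F :: 'v::infinite lit set set.
    F \<in> UHIT \<and> deficiency F = int k \<and> vars F \<noteq> {} \<and> b \<le> min_var_degree F"
proof -
  define F where "F = complete_cube n Ds"
  have F: "\<forall>C\<in>F. \<forall>x\<in>C. compl x \<notin> C" "\<forall>C\<in>F. \<forall>D\<in>F. C \<noteq> D \<longrightarrow> (\<exists>x\<in>C. compl x \<in> D)"
    "deficiency F = int k" "vars F \<noteq> {}" "min_var_degree F = b"
    using assms by (simp_all add: hitting_cube_def Let_def F_def)
  obtain g :: "nat \<Rightarrow> 'v" where g: "inj g" using ex_inj_nat by blast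
  have cs: "is_clause_set F" unfolding F_def by (rule is_clause_set_complete_cube[OF F(1)[unfolded F_def]])
  then have "\<not> satisfiable F" unfolding F_def by (rule complete_cube_unsatisfiable)
  then have "F \<in> UHIT" using cs F(2) by (simp add: UHIT_def)
  then show ?thesis
    using F(3-5) by (intro exI[of _ "rename g F"])
      (simp add: UHIT_rename[OF g] deficiency_rename[OF g] vars_rename[OF g] min_var_degree_rename[OF g])
qed

lemma full_clauses_var: "E \<in> set (full_clauses n) \<Longrightarrow> x \<in> set E \<Longrightarrow> lit_var x < n"
proof (induction n arbitrary: E)
  case (Suc n)
  then obtain C where C: "C \<in> set (full_clauses n)" "E = Pos n # C \<or> E = Neg n # C" by auto
  have "lit_var x < n \<or> x = Pos n \<or> x = Neg n" using Suc.IH[OF C(1)] C(2) Suc.prems(2) by auto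
  then show ?case by auto
qed simp

lemma full_clauses_iff:
  "E \<in> set (full_clauses n) \<Longrightarrow> v < n \<Longrightarrow> Neg v \<in> set E \<longleftrightarrow> Pos v \<notin> set E"
proof (induction n arbitrary: E)
  case (Suc n)
  then obtain C where C: "C \<in> set (full_clauses n)" "E = Pos n # C \<or> E = Neg n # C" by auto
  have "Pos n \<notin> set C" "Neg n \<notin> set C" using full_clauses_var[OF C(1)] by fastforce+
  then show ?case using C Suc.IH[OF C(1)] Suc.prems(2) by (cases "v = n") auto
qed simp

lemma irredundant_cube_fc:
  assumes "irredundant_cube n Ds (int k) b"
  shows "\<exists>F :: 'v::infinite lit set set. F \<in> MU \<and> deficiency F = int k \<and> b \<le> fc F"
proof -
  define F where "F = complete_cube n Ds"
  have F: "\<forall>C\<in>F. \<forall>x\<in>C. compl x \<notin> C"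
    and only: "\<forall>C\<in>F. \<exists>E\<in>set (full_clauses n). C \<subseteq> set E \<and> (\<forall>D\<in>F. D \<subseteq> set E \<longrightarrow> D = C)"
    and dF: "deficiency F = int k" "fc F = b"
    using assms by (simp_all add: irredundant_cube_def Let_def F_def)
  obtain g :: "nat \<Rightarrow> 'v" where g: "inj g" using ex_inj_nat by blast
  have cs: "is_clause_set F" unfolding F_def by (rule is_clause_set_complete_cube[OF F[unfolded F_def]])
  have unsat: "\<not> satisfiable F" using cs unfolding F_def by (rule complete_cube_unsatisfiable)
  have cl: "is_clause C" if "C \<in> F" for C using cs that by (simp add: is_clause_set_def)
  have below: "lit_var x < n" if "C \<in> F" "x \<in> C" for C x
  proof -
    obtain E where E: "E \<in> set (full_clauses n)" "C \<subseteq> set E"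
      using bspec[OF only \<open>C \<in> F\<close>] by (elim bexE conjE)
    show ?thesis by (rule full_clauses_var[OF E(1) subsetD[OF E(2) that(2)]])
  qed
  have "\<exists>f. only_falsifies F falsifier C f" if C: "C \<in> F" for C
  proof -
    obtain E where E: "E \<in> set (full_clauses n)" "C \<subseteq> set E" "\<forall>D\<in>F. D \<subseteq> set E \<longrightarrow> D = C"
      using bspec[OF only C] by (elim bexE conjE)
    \<comment> \<open>The point \<open>E\<close> as an assignment: on the variables below
      \<open>n\<close> it falsifies exactly the literals of \<open>E\<close>, hence exactly the
      clauses contained in \<open>E\<close>.\<close>
    define f where "f v = (Neg v \<in> set E)" for v
    have iff: "falsifies f (falsifier D) \<longleftrightarrow> D \<subseteq> set E" if D: "D \<in> F" for D
    proof -
      have eq: "(\<not> lit_true f x) = (x \<in> set E)" if "x \<in> D" for x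
      proof (cases x)
        case (Pos v)
        then have "v < n" using below[OF D that] by simp
        then show ?thesis using full_clauses_iff[OF E(1), of v] unfolding Pos f_def lit_true.simps by blast
      next
        case (Neg v)
        then show ?thesis by (simp add: f_def)
      qed
      show ?thesis unfolding falsifies_falsifier[OF cl[OF D]] subset_eq
        by (rule ball_cong[OF refl], rule eq)
    qed
    have "only_falsifies F falsifier C f"
      unfolding only_falsifies_def
    proof (intro conjI ballI impI)
      show "falsifies f (falsifier C)" using iff[OF C] E(2) by blast
      fix D assume D: "D \<in> F" "falsifies f (falsifier D)"
      show "D = C" using E(3) D(1) iff[OF D(1)] D(2) by blast
    qed
    then show ?thesis by blast
  qed
  then have "mu F (vars F) falsifier"
    using cs finite_vars[OF cs] unsat unsatisfiable_iff[OF cs]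
    by (auto simp: mu_def dom_falsifier is_clause_set_def vars_def)
  then have "F \<in> MU" using mu_imp_MU[OF cs] by blast
  then show ?thesis
    using dF by (intro exI[of _ "rename g F"])
      (simp add: MU_rename[OF g] deficiency_rename[OF g] fc_rename[OF g])
qed

text \<open>Each full clause contributes to every degree, which suffices except at 3, 7, 8 and 10,
  where \<open>vdm_bound\<close> exceeds \<open>fch_value\<close> and the cubes take over.\<close>

lemma UHIT_min_var_degree:
  assumes k: "1 \<le> k" "k \<le> 13"
  shows "\<exists>F :: 'v::infinite lit set set. F \<in> UHIT \<and> deficiency F = int k \<and> vars F \<noteq> {} \<and> vdm_bound k \<le> min_var_degree F"
proof -
  let ?E = "\<lambda>k b. \<exists>F :: 'v lit set set. F \<in> UHIT \<and> deficiency F = int k \<and> vars F \<noteq> {} \<and> b \<le> min_var_degree F"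
  have 3: "?E 3 5" by (rule hitting_cube_min_var_degree[OF hitting_cube_3])
  have 7: "?E 7 10" by (rule hitting_cube_min_var_degree[OF hitting_cube_7])
  have 8: "?E 8 11" by (rule hitting_cube_min_var_degree[OF hitting_cube_8])
  have 10: "?E 10 13" by (rule hitting_cube_min_var_degree[OF hitting_cube_10])
  have "k = 3 \<or> k = 7 \<or> k = 8 \<or> k = 10 \<or> vdm_bound k = fch_value k"
  proof -
    have "k = 1 \<or> k = 2 \<or> k = 3 \<or> k = 4 \<or> k = 5 \<or> k = 6 \<or> k = 7 \<or> k = 8 \<or> k = 9
      \<or> k = 10 \<or> k = 11 \<or> k = 12 \<or> k = 13" using k by presburger
    then show ?thesis by (elim disjE) (simp_all add: fch_value_def)
  qed
  moreover have "?E k (fch_value k)"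
  proof -
    obtain F :: "'v lit set set" where F: "F \<in> UHIT" "deficiency F = int k" "fch_value k \<le> fc F"
      using uhit_full_clauses[OF k] by blast
    have "fch_value k \<ge> 2"
    proof -
      have "k = 1 \<or> k = 2 \<or> k = 3 \<or> k = 4 \<or> k = 5 \<or> k = 6 \<or> k = 7 \<or> k = 8 \<or> k = 9
        \<or> k = 10 \<or> k = 11 \<or> k = 12 \<or> k = 13" using k by presburger
      then show ?thesis by (elim disjE) (simp_all add: fch_value_def)
    qed
    moreover have "fc {{} :: 'v lit set} \<le> 1"
      unfolding fc_def by (rule order_trans[OF card_mono[of "{{}}"]]) auto
    ultimately have "F \<noteq> {{}}" using F(3) by force
    then have "vars F \<noteq> {}" using vars_nonempty[OF UHIT_subset_MU[OF F(1)]] by blast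
    moreover have "is_clause_set F" using F(1) by (simp add: UHIT_def)
    ultimately show ?thesis using F fc_le_min_var_degree order_trans by blast
  qed
  ultimately show ?thesis using 3 7 8 10 by (elim disjE) simp_all
qed

section \<open>Values of the four quantities\<close>

lemma Max_eqI_bounded:
  fixes f :: "'a \<Rightarrow> nat"
  assumes "\<And>x. P x \<Longrightarrow> f x \<le> b" "\<exists>x. P x \<and> b \<le> f x"
  shows "Max {f x | x. P x} = b"
proof (rule Max_eqI)
  show "finite {f x | x. P x}" by (rule finite_subset[of _ "{..b}"]) (use assms(1) in auto)
  show "b \<in> {f x | x. P x}" using assms by (fastforce intro: antisym)
qed (use assms(1) in auto)

lemma VDM_value:
  assumes "1 \<le> k" "k \<le> 13"
  shows "VDM TYPE('v::infinite) k = vdm_bound k"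
  unfolding VDM_def
proof (rule Max_eqI_bounded)
  show "\<exists>F :: 'v lit set set. (F \<in> MU \<and> deficiency F = int k \<and> F \<noteq> {{}}) \<and> vdm_bound k \<le> min_var_degree F"
    using UHIT_min_var_degree[OF assms] UHIT_subset_MU by (fastforce simp: vars_def clause_vars_def)
qed (use assms min_var_degree_le in blast)

lemma VDH_value:
  assumes "1 \<le> k" "k \<le> 13"
  shows "VDH TYPE('v::infinite) k = vdm_bound k"
  unfolding VDH_def
proof (rule Max_eqI_bounded)
  show "\<exists>F :: 'v lit set set. (F \<in> UHIT \<and> deficiency F = int k \<and> F \<noteq> {{}}) \<and> vdm_bound k \<le> min_var_degree F"
    using UHIT_min_var_degree[OF assms] by (fastforce simp: vars_def clause_vars_def)
qed (use assms min_var_degree_le UHIT_subset_MU in blast)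

lemma FCM_value:
  assumes "1 \<le> k" "k \<le> 13"
  shows "FCM TYPE('v::infinite) k = fcm_bound k"
  unfolding FCM_def
proof (rule Max_eqI_bounded)
  have 7: "\<exists>F :: 'v lit set set. F \<in> MU \<and> deficiency F = int 7 \<and> 9 \<le> fc F"
    by (rule irredundant_cube_fc[OF irredundant_cube_7])
  have "k = 7 \<or> fcm_bound k = fch_value k"
  proof -
    have "k = 1 \<or> k = 2 \<or> k = 3 \<or> k = 4 \<or> k = 5 \<or> k = 6 \<or> k = 7 \<or> k = 8 \<or> k = 9
      \<or> k = 10 \<or> k = 11 \<or> k = 12 \<or> k = 13" using assms by presburger
    then show ?thesis by (elim disjE) (simp_all add: fch_value_def fcm_bound_def)
  qed
  then show "\<exists>F :: 'v lit set set. (F \<in> MU \<and> deficiency F = int k) \<and> fcm_bound k \<le> fc F"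
  proof
    assume "k = 7"
    then show ?thesis using 7 by (simp add: fcm_bound_def)
  next
    assume "fcm_bound k = fch_value k"
    then show ?thesis using uhit_full_clauses[OF assms, where ?'v = 'v] UHIT_subset_MU by fastforce
  qed
qed (use assms fc_le in blast)

lemma FCH_value:
  assumes "1 \<le> k" "k \<le> 13"
  shows "FCH TYPE('v::infinite) k = fch_value k"
  unfolding FCH_def
proof (rule Max_eqI_bounded)
  fix F :: "'v lit set set" assume F: "F \<in> UHIT \<and> deficiency F = int k"
  then have MU: "F \<in> MU" using UHIT_subset_MU by blast
  have d: "deficiency F = int k" using F by blast
  have le: "fc F \<le> fcm_bound k" using fc_le[OF MU d assms(2)] .
  show "fc F \<le> fch_value k"
  proof (cases "k = 7")
    case True
    \<comment> \<open>Parity lowers the bound 9 to 8; it presupposes a variable, and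
      \<open>{{}}\<close> has the wrong deficiency.\<close>
    have "card F \<noteq> 1" using F True by (auto simp: deficiency_def)
    then have "F \<noteq> {{}}" by auto
    then have "vars F \<noteq> {}" using vars_nonempty[OF MU] by simp
    then have "even (fc F)" using even_fc[of F] F by simp
    then have "fc F \<noteq> 9" by auto
    then show ?thesis using le True by (simp add: fcm_bound_def fch_value_def)
  next
    case False
    have "k = 1 \<or> k = 2 \<or> k = 3 \<or> k = 4 \<or> k = 5 \<or> k = 6 \<or> k = 8 \<or> k = 9
      \<or> k = 10 \<or> k = 11 \<or> k = 12 \<or> k = 13" using assms False by presburger
    then show ?thesis using le by (elim disjE) (simp_all add: fch_value_def fcm_bound_def)
  qed
qed (use uhit_full_clauses[OF assms] in blast)

section \<open>The number sequences\<close>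

text \<open>Factorials divide one another in order, so testing \<open>n\<close> and its predecessor
  decides the minimum.\<close>

lemma S2_eqI:
  assumes "2 ^ k dvd (fact n :: nat)" "\<not> 2 ^ k dvd (fact (n - 1) :: nat)"
  shows "S2 k = n"
  unfolding S2_def
proof (rule Least_equality)
  fix m assume m: "2 ^ k dvd (fact m :: nat)"
  show "n \<le> m"
  proof (rule ccontr)
    assume "\<not> n \<le> m"
    then have "(fact m :: nat) dvd fact (n - 1)" by (intro fact_dvd) simp
    then show False using m assms(2) dvd_trans by blast
  qed
qed (rule assms)

lemma upt_1_14: "[1..<14] = [1, 2, 3, 4, 5, 6, 7, 8, 9, 10, 11, 12, 13 :: nat]"
  by code_simp

lemma S2_values: "map S2 [1..<14] = [2,4,4,6,8,8,8,10,12,12,14,16,16]"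
proof -
  have "S2 1 = 2" "S2 2 = 4" "S2 3 = 4" "S2 4 = 6" "S2 5 = 8" "S2 6 = 8" "S2 7 = 8" "S2 8 = 10"
    "S2 9 = 12" "S2 10 = 12" "S2 11 = 14" "S2 12 = 16" "S2 13 = 16"
    by (rule S2_eqI; simp add: fact_numeral)+
  then show ?thesis unfolding upt_1_14 by simp
qed

definition non_Mersenne :: "nat set" where
  "non_Mersenne = {m. m \<ge> 1 \<and> \<not> (\<exists>n\<ge>1. m = 2 ^ n - 1)}"

lemma infinite_non_Mersenne: "infinite non_Mersenne"
  unfolding infinite_nat_iff_unbounded
proof
  fix m :: nat
  have "2 * Suc m \<noteq> 2 ^ n - 1" if n: "n \<ge> 1" for n
  proof -
    have "odd (2 ^ n - 1 :: nat)" using n by simp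
    then show ?thesis by (metis dvd_triv_left)
  qed
  then have "2 * Suc m \<in> non_Mersenne" by (auto simp: non_Mersenne_def)
  then show "\<exists>n>m. n \<in> non_Mersenne" by (intro exI[of _ "2 * Suc m"]) simp
qed

lemma non_Mersenne_iff:
  \<comment> \<open>The range ends at 17, the largest value needed, that of \<open>nM\<close> at
    13.\<close>
  assumes "m \<le> 17"
  shows "m \<in> non_Mersenne \<longleftrightarrow> m \<notin> {0, 1, 3, 7, 15}"
proof -
  have "(\<exists>n\<ge>1. m = 2 ^ n - 1) \<longleftrightarrow> m \<in> {1, 3, 7, 15}"
  proof
    assume "\<exists>n\<ge>1. m = 2 ^ n - 1"
    then obtain n where n: "n \<ge> 1" "m = 2 ^ n - 1" by blast
    have "n < 5"
    proof (rule ccontr)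
      assume "\<not> n < 5"
      then have "(2::nat) ^ 5 \<le> 2 ^ n" by (intro power_increasing) auto
      then show False using n(2) assms by simp
    qed
    then have "n = 1 \<or> n = 2 \<or> n = 3 \<or> n = 4" using n(1) by auto
    then show "m \<in> {1, 3, 7, 15}" using n(2) by auto
  next
    have "(1::nat) = 2 ^ 1 - 1" "(3::nat) = 2 ^ 2 - 1" "(7::nat) = 2 ^ 3 - 1" "(15::nat) = 2 ^ 4 - 1"
      by simp_all
    moreover assume "m \<in> {1, 3, 7, 15}"
    ultimately show "\<exists>n\<ge>1. m = 2 ^ n - 1"
      by (metis empty_iff insert_iff one_le_numeral order_refl)
  qed
  then show ?thesis by (auto simp: non_Mersenne_def)
qed

lemma enumerate_next:
  assumes "enumerate non_Mersenne n = a" "b \<le> 17" "a < b" "b \<notin> {0, 1, 3, 7, 15}"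
    and "{a<..<b} \<subseteq> {0, 1, 3, 7, 15}" and n': "n' = Suc n"
  shows "enumerate non_Mersenne n' = b"
  unfolding n' enumerate_Suc''[OF infinite_non_Mersenne] assms(1)
proof (rule Least_equality)
  show "b \<in> non_Mersenne \<and> a < b" using assms(2-4) non_Mersenne_iff by blast
  fix m assume m: "m \<in> non_Mersenne \<and> a < m"
  show "b \<le> m"
  proof (rule ccontr)
    assume "\<not> b \<le> m"
    then have "m \<in> {a<..<b}" "m \<le> 17" using assms(2) m by auto
    then have "m \<le> 17" "m \<in> {0, 1, 3, 7, 15}" using assms(5) by blast+
    then show False using m non_Mersenne_iff by blast
  qed
qed

lemma nM_values: "map nM [1..<14] = [2,4,5,6,8,9,10,11,12,13,14,16,17]"
proof -
  have 0: "enumerate non_Mersenne 0 = 2"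
    unfolding enumerate_0
  proof (rule Least_equality)
    show "2 \<in> non_Mersenne" using non_Mersenne_iff[of 2] by simp
    fix m assume m: "m \<in> non_Mersenne"
    show "2 \<le> m"
    proof (rule ccontr)
      assume "\<not> 2 \<le> m"
      then show False using m non_Mersenne_iff[of m] by (auto simp: less_2_cases_iff not_le)
    qed
  qed
  have 1: "enumerate non_Mersenne 1 = 4" by (rule enumerate_next[OF 0]) (auto simp: greaterThanLessThan_iff)
  have 2: "enumerate non_Mersenne 2 = 5" by (rule enumerate_next[OF 1]) (auto simp: greaterThanLessThan_iff)
  have 3: "enumerate non_Mersenne 3 = 6" by (rule enumerate_next[OF 2]) (auto simp: greaterThanLessThan_iff)
  have 4: "enumerate non_Mersenne 4 = 8" by (rule enumerate_next[OF 3]) (auto simp: greaterThanLessThan_iff)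
  have 5: "enumerate non_Mersenne 5 = 9" by (rule enumerate_next[OF 4]) (auto simp: greaterThanLessThan_iff)
  have 6: "enumerate non_Mersenne 6 = 10" by (rule enumerate_next[OF 5]) (auto simp: greaterThanLessThan_iff)
  have 7: "enumerate non_Mersenne 7 = 11" by (rule enumerate_next[OF 6]) (auto simp: greaterThanLessThan_iff)
  have 8: "enumerate non_Mersenne 8 = 12" by (rule enumerate_next[OF 7]) (auto simp: greaterThanLessThan_iff)
  have 9: "enumerate non_Mersenne 9 = 13" by (rule enumerate_next[OF 8]) (auto simp: greaterThanLessThan_iff)
  have 10: "enumerate non_Mersenne 10 = 14" by (rule enumerate_next[OF 9]) (auto simp: greaterThanLessThan_iff)
  have 11: "enumerate non_Mersenne 11 = 16" by (rule enumerate_next[OF 10]) (auto simp: greaterThanLessThan_iff)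
  have 12: "enumerate non_Mersenne 12 = 17" by (rule enumerate_next[OF 11]) (auto simp: greaterThanLessThan_iff)
  have "nM k = enumerate non_Mersenne (k - 1)" for k by (simp add: nM_def non_Mersenne_def)
  then show ?thesis using 0 1 2 3 4 5 6 7 8 9 10 11 12 unfolding upt_1_14 by simp
qed

lemma nM1_special_iff:
  assumes "1 \<le> k" "k \<le> 13"
  shows "(\<exists>n\<ge>3. k = 2 ^ n - n + 1) \<longleftrightarrow> k = 6 \<or> k = 13"
proof
  assume "\<exists>n\<ge>3. k = 2 ^ n - n + 1"
  then obtain n where n: "n \<ge> 3" "k = 2 ^ n - n + 1" by blast
  have "n < 5"
  proof (rule ccontr)
    assume "\<not> n < 5"
    then have "5 \<le> n" by simp
    \<comment> \<open>Equality holds at 5, so from there on the special arguments are at least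
      28.\<close>
    then have "n + 27 \<le> 2 ^ n" by (induction n rule: dec_induct) auto
    then show False using n(2) assms(2) by simp
  qed
  then have "n = 3 \<or> n = 4" using n(1) by auto
  then show "k = 6 \<or> k = 13" using n(2) by auto
next
  assume "k = 6 \<or> k = 13"
  then show "\<exists>n\<ge>3. k = 2 ^ n - n + 1"
  proof
    assume "k = 6" then show ?thesis by (intro exI[of _ 3]) simp
  next
    assume "k = 13" then show ?thesis by (intro exI[of _ 4]) simp
  qed
qed

lemma nM1_values: "map nM1 [1..<14] = [2,4,5,6,8,8,10,11,12,13,14,16,16]"
proof -
  have "nM1 k = (if k = 6 \<or> k = 13 then nM k - 1 else nM k)" if "k \<in> set [1..<14]" for k
  proof -
    have "1 \<le> k" "k \<le> 13" using that by auto
    then show ?thesis unfolding nM1_def by (simp only: nM1_special_iff)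
  qed
  then have "map nM1 [1..<14] = map (\<lambda>k. if k = 6 \<or> k = 13 then nM k - 1 else nM k) [1..<14]"
    by (rule map_cong[OF refl])
  then show ?thesis using nM_values unfolding upt_1_14 by simp
qed

theorem theorem7p3:
  shows "map nM [1..<14] = [2,4,5,6,8,9,10,11,12,13,14,16,17] \<and>
         map nM1 [1..<14] = [2,4,5,6,8,8,10,11,12,13,14,16,16] \<and>
         map (VDM TYPE('v::infinite)) [1..<14] = [2,4,5,6,8,8,10,11,12,13,14,16,16] \<and>
         map (VDH TYPE('v)) [1..<14] = [2,4,5,6,8,8,10,11,12,13,14,16,16] \<and>
         map (FCM TYPE('v)) [1..<14] = [2,4,4,6,8,8,9,10,12,12,14,16,16] \<and>
         map (FCH TYPE('v)) [1..<14] = [2,4,4,6,8,8,8,10,12,12,14,16,16] \<and>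
         map S2 [1..<14] = [2,4,4,6,8,8,8,10,12,12,14,16,16]"
proof -
  have *: "map f [1..<14] = map g [1..<14]"
    if "\<And>k. 1 \<le> k \<Longrightarrow> k \<le> 13 \<Longrightarrow> f k = g k" for f g :: "nat \<Rightarrow> nat"
    by (rule map_cong[OF refl], rule that) auto
  have VDM: "map (VDM TYPE('v)) [1..<14] = [2,4,5,6,8,8,10,11,12,13,14,16,16]"
    by (subst *[OF VDM_value]) (assumption | code_simp)+
  have VDH: "map (VDH TYPE('v)) [1..<14] = [2,4,5,6,8,8,10,11,12,13,14,16,16]"
    by (subst *[OF VDH_value]) (assumption | code_simp)+
  have FCM: "map (FCM TYPE('v)) [1..<14] = [2,4,4,6,8,8,9,10,12,12,14,16,16]"
    by (subst *[OF FCM_value]) (assumption | code_simp)+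
  have FCH: "map (FCH TYPE('v)) [1..<14] = [2,4,4,6,8,8,8,10,12,12,14,16,16]"
    by (subst *[OF FCH_value]) (assumption | code_simp)+
  show ?thesis
    by (intro conjI nM_values nM1_values VDM VDH FCM FCH S2_values)
qed

end
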